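(* Let $X=(X_t)_{t\ge0}$ be a real Lévy process with characteristics $(a,0,\nu)$ and index $\beta$ such that $\beta\in(0,2)$. Assume that $\mathbb{E}\,|X_1|^\beta<+\infty$ if $\beta\neq1$, and that $\mathbb{E}\,|X_1|^p<+\infty$ for some $p\in(0,1]$ if $\beta=1$. Assume that there are $c\in(0,1]$ and $C\in(0,\infty)$ such that the Lévy measure satisfies $$\mathbf{1}_{\{0<|x|\le c\}}\,\nu(dx)\le\frac{C}{|x|^{\beta+1}}\,\mathbf{1}_{\{0<|x|\le c\}}\,dx .$$ Then as $t\to0$ $$\mathbb{E}\,\sup_{s\le t}|X_s|^\beta=O(t(-\log t))\quad\text{if }\beta>1,$$ $$\mathbb{E}\,\sup_{s\le t}|Y_s|^\beta=O(t(-\log t))\quad\text{if }\beta<1,$$ and $$\mathbb{E}\,\sup_{s\le t}|X_s|^p=O\left((t(-\log t))^p\right)\quad\text{if }\beta=1,\ p\le1,$$ where, for $\beta<1$, $Y_t=X_t-t\left(a-\int_{\{|x|\le1\}}x\,d\nu(x)\right)$.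
   Context: A (càdlàg) real Lévy process $X=(X_t)_{t\ge0}$ has characteristics $(a,\sigma^2,\nu)$ if $\mathbb{E}\,e^{iuX_t}=e^{-t\Psi(u)}$ for all $u\in\mathbb{R}$, $t\ge 0$, with $$\Psi(u)=-iua+\tfrac12\sigma^2u^2-\int\left(e^{iux}-1-iux\mathbf{1}_{\{|x|\le1\}}\right)d\nu(x),$$ where $a\in\mathbb{R}$, $\sigma^2\ge0$, and $\nu$ (the Lévy measure) is a measure on $\mathbb{R}$ with $\nu(\{0\})=0$ and $\int (x^2\wedge1)\,d\nu(x)<+\infty$. Characteristics $(a,0,\nu)$ means $\sigma^2=0$, i.e. $X$ has no Brownian component. The index of $X$ is $\beta=\inf\{p>0:\int_{\{|x|\le1\}}|x|^p\,d\nu(x)<+\infty\}\in[0,2]$. An inequality between measures means inequality on every Borel set. The suprema $\sup_{s\le t}$ are over $s\in[0,t]$. Implied constants in $O(\cdot)$ may depend on everything except $t$. *)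

theory Defs
  imports "HOL-Probability.Probability" "HOL-Library.Landau_Symbols"
begin

definition cadlag :: "(real \<Rightarrow> real) \<Rightarrow> bool" where
  "cadlag f \<longleftrightarrow>
     (\<forall>t\<ge>0. (f \<longlongrightarrow> f t) (at_right t)) \<and> (\<forall>t>0. \<exists>l. (f \<longlongrightarrow> l) (at_left t))"

text \<open>
  The time set is the nonnegative half-line: the values \<open>X t\<close> for \<open>t < 0\<close> are unconstrained
  and irrelevant.  Paths are required to be cadlag and to start in 0 almost surely only.
\<close>

locale levy_process = prob_space M for M :: "'a measure" +
  fixes X :: "real \<Rightarrow> 'a \<Rightarrow> real"
  assumes random_variable_X: "\<And>t. 0 \<le> t \<Longrightarrow> random_variable borel (X t)"
    and X_zero: "AE \<omega> in M. X 0 \<omega> = 0"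
    and indep_increments:
      "\<And>(n::nat) (\<tau>::nat \<Rightarrow> real). 0 \<le> \<tau> 0 \<Longrightarrow> (\<And>i. i < n \<Longrightarrow> \<tau> i \<le> \<tau> (Suc i)) \<Longrightarrow>
         indep_vars (\<lambda>_. borel) (\<lambda>i \<omega>. X (\<tau> (Suc i)) \<omega> - X (\<tau> i) \<omega>) {..<n}"
    and stationary_increments:
      "\<And>s h. 0 \<le> s \<Longrightarrow> 0 \<le> h \<Longrightarrow>
         distr M borel (\<lambda>\<omega>. X (s + h) \<omega> - X s \<omega>) = distr M borel (X h)"
    and cadlag_paths: "AE \<omega> in M. cadlag (\<lambda>t. X t \<omega>)"

definition levy_measure :: "real measure \<Rightarrow> bool" where
  "levy_measure \<nu> \<longleftrightarrow> sets \<nu> = sets borel \<and> emeasure \<nu> {0} = 0 \<and>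
     (\<integral>\<^sup>+x. ennreal (min (x\<^sup>2) 1) \<partial>\<nu>) < \<infinity>"

definition levy_exponent :: "real \<Rightarrow> real \<Rightarrow> real measure \<Rightarrow> real \<Rightarrow> complex" where
  "levy_exponent a \<sigma>2 \<nu> u =
     - \<i> * of_real u * of_real a + of_real (\<sigma>2 * u\<^sup>2 / 2)
     - (CLINT x|\<nu>. iexp (u * x) - 1 - \<i> * of_real (u * x * indicator {x. \<bar>x\<bar> \<le> 1} x))"

text \<open>The second parameter \<open>\<sigma>2\<close> is the variance \<open>\<sigma>\<^sup>2\<close>, not its square root.\<close>

definition has_characteristics ::
  "'a measure \<Rightarrow> (real \<Rightarrow> 'a \<Rightarrow> real) \<Rightarrow> real \<Rightarrow> real \<Rightarrow> real measure \<Rightarrow> bool" where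
  "has_characteristics M X a \<sigma>2 \<nu> \<longleftrightarrow> 0 \<le> \<sigma>2 \<and> levy_measure \<nu> \<and>
     (\<forall>u. \<forall>t\<ge>0. (CLINT \<omega>|M. iexp (u * X t \<omega>)) = exp (- of_real t * levy_exponent a \<sigma>2 \<nu> u))"

definition levy_index :: "real measure \<Rightarrow> real" where
  "levy_index \<nu> = Inf {p. 0 < p \<and> (\<integral>\<^sup>+x\<in>{x. \<bar>x\<bar> \<le> 1}. ennreal (\<bar>x\<bar> powr p) \<partial>\<nu>) < \<infinity>}"

definition sup_moment ::
  "'a measure \<Rightarrow> (real \<Rightarrow> 'a \<Rightarrow> real) \<Rightarrow> real \<Rightarrow> real \<Rightarrow> ennreal" where
  "sup_moment M Z p t = (\<integral>\<^sup>+\<omega>. (SUP s\<in>{0..t}. ennreal (\<bar>Z s \<omega>\<bar> powr p)) \<partial>M)"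

text \<open>
  Since \<^const>\<open>enn2real\<close> maps \<open>\<infinity>\<close> to 0, finiteness near 0 has to be demanded separately from the
  Landau bound.
\<close>

definition bigo_at_zero :: "(real \<Rightarrow> ennreal) \<Rightarrow> (real \<Rightarrow> real) \<Rightarrow> bool" where
  "bigo_at_zero f g \<longleftrightarrow>
     (\<forall>\<^sub>F t in at_right 0. f t < \<infinity>) \<and> (\<lambda>t. enn2real (f t)) \<in> O[at_right 0](g)"

end

theory Submission imports Defs begin

text \<open>
  The proof works with characteristic functions alone.  For a random variable \<open>Z\<close> with
  characteristic function \<open>\<phi>\<close>, integrating \<open>1 - Re \<phi>(v) = E (1 - cos (v Z))\<close> against
  \<open>v powr (- p - 1)\<close> over \<open>v > 0\<close> gives a constant multiple of \<open>E \<bar>Z\<bar> powr p\<close>, for \<open>0 < p < 2\<close>.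
  For a Levy process an upper bound of this kind holds even for the supremum: Ottaviani's
  inequality bounds the tail of the supremum by the tail of single values \<open>X s\<close>, this tail is at most an
  average of \<open>1 - Re \<phi>\<^sub>s\<close> over low frequencies, and the layer-cake formula with
  Tonelli's theorem turns the tail bound into a bound for the moment: up to a constant, the
  moment of the supremum over \<open>[0, t]\<close> is at most the integral of \<open>h(v) v powr (- p - 1)\<close>, for every
  \<open>h\<close> that dominates \<open>1 - Re \<phi>\<^sub>s\<close> for all \<open>s \<le> t\<close> (\<open>sup_moment_le_char_defect\<close>).

  It remains to choose \<open>h\<close>.  Let \<open>\<Psi>\<close> be the characteristic exponent.  Below some fixed \<open>\<delta>\<close>,
  where \<open>\<bar>\<Psi>\<bar> \<le> 1\<close>, the function \<open>1 - Re \<phi>\<^sub>s\<close> is at most \<open>10 t (1 - Re \<phi>\<^sub>1)\<close>, so the moment of \<open>X 1\<close>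
  makes this part \<open>O(t)\<close>.  Between \<open>\<delta>\<close> and a cutoff \<open>T\<close> the elementary bound
  \<open>1 - Re (exp (- s \<Psi>)) \<le> s Re \<Psi> + (s Im \<Psi>)\<^sup>2\<close> is used, and above \<open>T\<close> the bound 2.
  The density bound on the small jumps gives \<open>\<bar>\<Psi>(v)\<bar> = O(v powr \<beta>)\<close> at infinity, by scaling, if \<open>\<beta> > 1\<close>,
  and also if \<open>\<beta> < 1\<close> once the drift is removed.  With \<open>p = \<beta>\<close> the middle part is then \<open>t\<close> times the
  integral of \<open>1 / v\<close> from \<open>\<delta>\<close> to \<open>T = t powr (- 1 / \<beta>)\<close>, which is where the logarithm comes from.
  For \<open>\<beta> = 1\<close> the real part of \<open>\<Psi>\<close> is still \<open>O(v)\<close>, but the imaginary part is only \<open>O(v ln v)\<close>.  It enters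
  squared and multiplied by \<open>t\<^sup>2\<close>, so with \<open>T = 1 / (t (- ln t))\<close> all three parts have the
  order of the claim.
\<close>

section \<open>Power integrals\<close>

lemma nn_integral_powr_from_0:
  fixes q b :: real
  assumes "-1 < q" "0 \<le> b"
  shows "(\<integral>\<^sup>+x. ennreal (x powr q) * indicator {0<..b} x \<partial>lborel) = ennreal (b powr (q + 1) / (q + 1))"
proof -
  have "((\<lambda>x. x powr q) has_integral (b powr (q + 1) / (q + 1))) {0..b}"
    using assms by (rule has_integral_powr_from_0)
  then have "((\<lambda>x. if x \<in> {0..b} then x powr q else 0) has_integral (b powr (q + 1) / (q + 1))) UNIV"
    by (simp only: has_integral_restrict_UNIV)
  also have "(\<lambda>x. if x \<in> {0..b} then x powr q else 0) = (\<lambda>x. x powr q * indicator {0<..b} x)"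
    by (auto simp: fun_eq_iff indicator_def)
  finally have "(\<integral>\<^sup>+x. ennreal (x powr q * indicator {0<..b} x) \<partial>lborel) = ennreal (b powr (q + 1) / (q + 1))"
    by (intro nn_integral_has_integral_lborel) auto
  then show ?thesis
    by (simp add: ennreal_mult' ennreal_indicator)
qed

lemma nn_integral_powr_to_inf:
  fixes q b :: real
  assumes "q < -1" "0 < b"
  shows "(\<integral>\<^sup>+x. ennreal (x powr q) * indicator {b<..} x \<partial>lborel) = ennreal (b powr (q + 1) / (- q - 1))"
proof -
  have "((\<lambda>x. x powr q) has_integral (- (b powr (q + 1)) / (q + 1))) {b..}"
    using assms by (rule has_integral_powr_to_inf)
  then have "((\<lambda>x. if x \<in> {b..} then x powr q else 0) has_integral (- (b powr (q + 1)) / (q + 1))) UNIV"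
    by (simp only: has_integral_restrict_UNIV)
  also have "(\<lambda>x. if x \<in> {b..} then x powr q else 0) = (\<lambda>x. x powr q * indicator {b..} x)"
    by (auto simp: fun_eq_iff indicator_def)
  finally have "(\<integral>\<^sup>+x. ennreal (x powr q * indicator {b..} x) \<partial>lborel) = ennreal (- (b powr (q + 1)) / (q + 1))"
    by (intro nn_integral_has_integral_lborel) auto
  also have "- (b powr (q + 1)) / (q + 1) = b powr (q + 1) / (- q - 1)"
    using assms by (simp add: field_simps)
  also have "(\<integral>\<^sup>+x. ennreal (x powr q * indicator {b..} x) \<partial>lborel)
      = (\<integral>\<^sup>+x. ennreal (x powr q) * indicator {b<..} x \<partial>lborel)"
    by (rule nn_integral_cong_AE, rule AE_mp[OF AE_lborel_singleton[of b]])
       (auto simp: ennreal_mult' ennreal_indicator indicator_def)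
  finally show ?thesis .
qed

lemma nn_integral_inverse_log:
  fixes d T :: real
  assumes "0 < d" "d \<le> T"
  shows "(\<integral>\<^sup>+x. ennreal (x powr -1) * indicator {d<..T} x \<partial>lborel) \<le> ennreal (ln (T / d))"
proof -
  have "(\<integral>\<^sup>+x. ennreal (x powr -1) * indicator {d<..T} x \<partial>lborel)
      \<le> (\<integral>\<^sup>+x. ennreal (1 / x) * indicator {d..T} x \<partial>lborel)"
    using assms by (intro nn_integral_mono) (auto simp: indicator_def powr_minus divide_inverse)
  also have "\<dots> = ennreal (ln T - ln d)"
  proof (rule nn_integral_FTC_Icc)
    show "(ln has_real_derivative 1 / x) (at x)" if "x \<in> {d..T}" for x
      using assms that by (auto intro!: derivative_eq_intros)
  qed (use assms in auto)
  also have "ln T - ln d = ln (T / d)"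
    using assms by (simp add: ln_div)
  finally show ?thesis .
qed

text \<open>
  Substituting \<open>y = v x\<close> shows that this integral is a constant times \<open>v powr \<beta>\<close>; splitting at
  \<open>x = 1 / v\<close> gives the value of the constant.  The lemma is used twice: with \<open>x\<close> the jump size, to bound the
  characteristic exponent at frequency \<open>v\<close>, and with \<open>x\<close> the frequency, to bound an integral
  over frequencies by a moment.
\<close>
lemma nn_integral_truncated_power:
  fixes v \<beta> \<gamma> \<kappa> :: real
  assumes v: "0 < v" and \<gamma>: "\<gamma> < \<beta>" and \<kappa>: "\<beta> < \<kappa>"
  shows "(\<integral>\<^sup>+x. ennreal (min ((v * x) powr \<kappa>) ((v * x) powr \<gamma>) * x powr (- \<beta> - 1)) * indicator {0<..} x \<partial>lborel)
    \<le> ennreal (v powr \<beta> * (1 / (\<kappa> - \<beta>) + 1 / (\<beta> - \<gamma>)))"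
proof -
  let ?f1 = "\<lambda>x. ennreal (v powr \<kappa>) * (ennreal (x powr (\<kappa> - \<beta> - 1)) * indicator {0<..1 / v} x)"
  let ?f2 = "\<lambda>x. ennreal (v powr \<gamma>) * (ennreal (x powr (\<gamma> - \<beta> - 1)) * indicator {1 / v<..} x)"
  have pw: "(v * x) powr r * x powr (- \<beta> - 1) = v powr r * x powr (r - \<beta> - 1)" if "0 < x" for r x
    using v that powr_add[of x r "- \<beta> - 1"] by (simp add: powr_mult add_diff_eq)
  have "(\<integral>\<^sup>+x. ennreal (min ((v * x) powr \<kappa>) ((v * x) powr \<gamma>) * x powr (- \<beta> - 1)) * indicator {0<..} x \<partial>lborel)
      \<le> (\<integral>\<^sup>+x. ?f1 x + ?f2 x \<partial>lborel)"
  proof (intro nn_integral_mono)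
    fix x :: real
    have "min ((v * x) powr \<kappa>) ((v * x) powr \<gamma>) * x powr (- \<beta> - 1) \<le> v powr r * x powr (r - \<beta> - 1)"
      if "0 < x" "r = \<kappa> \<or> r = \<gamma>" for r
      unfolding pw[OF that(1), symmetric] using that by (intro mult_right_mono) auto
    then show "ennreal (min ((v * x) powr \<kappa>) ((v * x) powr \<gamma>) * x powr (- \<beta> - 1)) * indicator {0<..} x \<le> ?f1 x + ?f2 x"
      using v by (cases "x \<le> 1 / v") (auto simp: indicator_def ennreal_mult'[symmetric])
  qed
  also have "\<dots> = ennreal (v powr \<kappa>) * ennreal ((1 / v) powr (\<kappa> - \<beta>) / (\<kappa> - \<beta>))
      + ennreal (v powr \<gamma>) * ennreal ((1 / v) powr (\<gamma> - \<beta>) / (\<beta> - \<gamma>))"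
    using assms nn_integral_powr_from_0[of "\<kappa> - \<beta> - 1" "1 / v"] nn_integral_powr_to_inf[of "\<gamma> - \<beta> - 1" "1 / v"]
    by (simp add: nn_integral_add nn_integral_cmult)
  also have "\<dots> = ennreal (v powr \<kappa> * (1 / v) powr (\<kappa> - \<beta>) / (\<kappa> - \<beta>) + v powr \<gamma> * (1 / v) powr (\<gamma> - \<beta>) / (\<beta> - \<gamma>))"
    using assms by (simp add: ennreal_mult'[symmetric] ennreal_plus[symmetric] del: ennreal_plus)
  also have "v powr \<kappa> * (1 / v) powr (\<kappa> - \<beta>) = v powr \<beta>"
    using v by (simp add: powr_divide powr_diff)
  also have "v powr \<gamma> * (1 / v) powr (\<gamma> - \<beta>) = v powr \<beta>"
    using v by (simp add: powr_divide powr_diff)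
  finally show ?thesis by (simp add: algebra_simps)
qed

lemma nn_integral_lborel_abs:
  fixes g :: "real \<Rightarrow> ennreal"
  assumes [measurable]: "g \<in> borel_measurable borel"
  shows "(\<integral>\<^sup>+x. g \<bar>x\<bar> * indicator (- {0}) x \<partial>lborel) = 2 * (\<integral>\<^sup>+x. g x * indicator {0<..} x \<partial>lborel)"
proof -
  have "(\<integral>\<^sup>+x. g \<bar>x\<bar> * indicator (- {0}) x \<partial>lborel)
      = (\<integral>\<^sup>+x. g x * indicator {0<..} x + g (- x) * indicator {..<0} x \<partial>lborel)"
    by (intro nn_integral_cong) (auto simp: indicator_def)
  also have "\<dots> = (\<integral>\<^sup>+x. g x * indicator {0<..} x \<partial>lborel) + (\<integral>\<^sup>+x. g (- x) * indicator {..<0} x \<partial>lborel)"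
    by (intro nn_integral_add) auto
  also have "(\<integral>\<^sup>+x. g (- x) * indicator {..<0} x \<partial>lborel) = (\<integral>\<^sup>+x. g x * indicator {0<..} x \<partial>lborel)"
    by (subst nn_integral_real_affine[where c="-1" and t=0])
       (auto intro!: nn_integral_cong simp: indicator_def)
  finally show ?thesis by (simp add: mult_2)
qed

section \<open>Moments and tails in terms of the characteristic function\<close>

text \<open>This is \<open>1 - Re \<phi>(v)\<close> for the characteristic function \<open>\<phi>\<close> of \<open>Z\<close>; as a nonnegative
  integral it is ready for Tonelli's theorem.\<close>
definition char_defect :: "'a measure \<Rightarrow> ('a \<Rightarrow> real) \<Rightarrow> real \<Rightarrow> ennreal" where
  "char_defect M Z v = (\<integral>\<^sup>+\<omega>. ennreal (1 - cos (v * Z \<omega>)) \<partial>M)"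

lemma (in prob_space) char_defect_measurable [measurable]:
  assumes [measurable]: "random_variable borel Z"
  shows "char_defect M Z \<in> borel_measurable borel"
  unfolding char_defect_def by measurable

lemma (in prob_space) char_defect_eq:
  assumes [measurable]: "random_variable borel Z"
  shows "char_defect M Z v = ennreal (1 - Re (CLINT \<omega>|M. iexp (v * Z \<omega>)))"
proof -
  have int: "integrable M (\<lambda>\<omega>. iexp (v * Z \<omega>))"
    by (intro integrable_const_bound[where B=1]) auto
  have "Re (CLINT \<omega>|M. iexp (v * Z \<omega>)) = (LINT \<omega>|M. Re (iexp (v * Z \<omega>)))"
    using integral_Re[OF int] by simp
  also have "(\<lambda>\<omega>. Re (iexp (v * Z \<omega>))) = (\<lambda>\<omega>. cos (v * Z \<omega>))"
    by (simp add: Re_exp)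
  finally have "1 - Re (CLINT \<omega>|M. iexp (v * Z \<omega>)) = (LINT \<omega>|M. 1 - cos (v * Z \<omega>))"
    by (subst Bochner_Integration.integral_diff)
       (auto simp: prob_space intro!: integrable_const_bound[where B=1])
  moreover have "char_defect M Z v = ennreal (LINT \<omega>|M. 1 - cos (v * Z \<omega>))"
    unfolding char_defect_def
    by (intro nn_integral_eq_integral Bochner_Integration.integrable_diff)
       (auto intro!: integrable_const_bound[where B=1])
  ultimately show ?thesis by simp
qed

lemma (in prob_space) char_defect_le_2: "char_defect M Z v \<le> 2"
proof -
  have "char_defect M Z v \<le> (\<integral>\<^sup>+\<omega>. 2 \<partial>M)"
    unfolding char_defect_def
  proof (intro nn_integral_mono)
    fix \<omega>
    have "1 - cos (v * Z \<omega>) \<le> 2" using cos_ge_minus_one[of "v * Z \<omega>"] by linarith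
    then show "ennreal (1 - cos (v * Z \<omega>)) \<le> 2"
      using ennreal_leI[of "1 - cos (v * Z \<omega>)" 2] by simp
  qed
  then show ?thesis by (simp add: emeasure_space_1)
qed

text \<open>
  For \<open>\<bar>z\<bar> \<ge> x\<close> the average of \<open>1 - cos (v z)\<close> over \<open>v \<in> [0, 2/x]\<close> is
  \<open>1 - sin (2z/x) / (2z/x) \<ge> 1/2\<close>.
\<close>
lemma (in prob_space) tail_le_char_defect:
  fixes Z :: "'a \<Rightarrow> real"
  assumes Z [measurable]: "random_variable borel Z" and x: "0 < x"
  shows "emeasure M {\<omega> \<in> space M. x \<le> \<bar>Z \<omega>\<bar>}
    \<le> ennreal x * (\<integral>\<^sup>+v. char_defect M Z v * indicator {0<..2 / x} v \<partial>lborel)"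
proof -
  interpret P: pair_sigma_finite M lborel ..
  have inner: "1 \<le> ennreal x * (\<integral>\<^sup>+v. ennreal (1 - cos (v * z)) * indicator {0<..2 / x} v \<partial>lborel)"
    if z: "x \<le> \<bar>z\<bar>" for z :: real
  proof -
    have z0: "z \<noteq> 0" using z x by auto
    have "(\<integral>\<^sup>+v. ennreal (1 - cos (v * z)) * indicator {0<..2 / x} v \<partial>lborel)
        = (\<integral>\<^sup>+v. ennreal (1 - cos (v * z)) * indicator {0..2 / x} v \<partial>lborel)"
      by (intro nn_integral_cong) (auto simp: indicator_def)
    also have "\<dots> = ennreal ((2 / x - sin (2 / x * z) / z) - (0 - sin (0 * z) / z))"
      using x z0
      by (intro nn_integral_FTC_Icc)
         (auto intro!: derivative_eq_intros)
    also have "\<dots> = ennreal (2 / x - sin (2 / x * z) / z)" by simp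
    finally have eq: "(\<integral>\<^sup>+v. ennreal (1 - cos (v * z)) * indicator {0<..2 / x} v \<partial>lborel)
      = ennreal (2 / x - sin (2 / x * z) / z)" .
    have "sin (2 / x * z) / z \<le> \<bar>sin (2 / x * z)\<bar> / \<bar>z\<bar>"
      using abs_ge_self[of "sin (2 / x * z) / z"] by (simp add: abs_divide)
    also have "\<dots> \<le> 1 / x"
      using x z by (intro frac_le) auto
    finally have "x * (1 / x) \<le> x * (2 / x - sin (2 / x * z) / z)"
      using x by (intro mult_left_mono) auto
    then have "1 \<le> ennreal (x * (2 / x - sin (2 / x * z) / z))"
      using x by (simp flip: ennreal_1 add: ennreal_leI)
    then show ?thesis unfolding eq using x by (simp add: ennreal_mult')
  qed
  have "emeasure M {\<omega> \<in> space M. x \<le> \<bar>Z \<omega>\<bar>} = (\<integral>\<^sup>+\<omega>. indicator {\<omega> \<in> space M. x \<le> \<bar>Z \<omega>\<bar>} \<omega> \<partial>M)"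
    by simp
  also have "\<dots> \<le> (\<integral>\<^sup>+\<omega>. ennreal x * (\<integral>\<^sup>+v. ennreal (1 - cos (v * Z \<omega>)) * indicator {0<..2 / x} v \<partial>lborel) \<partial>M)"
    using inner by (intro nn_integral_mono) (auto simp: indicator_def)
  also have "\<dots> = ennreal x * (\<integral>\<^sup>+\<omega>. (\<integral>\<^sup>+v. ennreal (1 - cos (v * Z \<omega>)) * indicator {0<..2 / x} v \<partial>lborel) \<partial>M)"
    by (intro nn_integral_cmult) measurable
  also have "(\<integral>\<^sup>+\<omega>. (\<integral>\<^sup>+v. ennreal (1 - cos (v * Z \<omega>)) * indicator {0<..2 / x} v \<partial>lborel) \<partial>M)
      = (\<integral>\<^sup>+v. (\<integral>\<^sup>+\<omega>. ennreal (1 - cos (v * Z \<omega>)) * indicator {0<..2 / x} v \<partial>M) \<partial>lborel)"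
    by (intro P.Fubini'[symmetric]) measurable
  also have "\<dots> = (\<integral>\<^sup>+v. char_defect M Z v * indicator {0<..2 / x} v \<partial>lborel)"
    unfolding char_defect_def by (intro nn_integral_cong nn_integral_multc) auto
  finally show ?thesis .
qed

lemma one_minus_cos_le_square: "1 - cos y \<le> y\<^sup>2 / 2" for y :: real
proof -
  have "(sin (y / 2))\<^sup>2 \<le> (y / 2)\<^sup>2"
    using abs_sin_x_le_abs_x[of "y / 2"] by (simp only: abs_le_square_iff)
  then show ?thesis
    using cos_double_sin[of "y / 2"] by (simp add: power2_eq_square)
qed

lemma one_minus_cos_le: "1 - cos y \<le> 2 * min (\<bar>y\<bar> powr 2) (\<bar>y\<bar> powr 0)" for y :: real
proof (cases "y = 0")
  case False
  then show ?thesis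
    using one_minus_cos_le_square[of y] cos_ge_minus_one[of y] zero_le_power2[of y]
    by (auto simp: min_def simp del: cos_ge_minus_one; linarith)
qed simp

text \<open>
  By scaling, the integral of \<open>1 - cos (v z)\<close> against \<open>v powr (- p - 1)\<close> is a multiple of \<open>\<bar>z\<bar> powr p\<close>;
  Tonelli's theorem exchanges it with the expectation.
\<close>
lemma (in prob_space) char_defect_integral_finite:
  fixes Z :: "'a \<Rightarrow> real"
  assumes Z [measurable]: "random_variable borel Z" and p: "0 < p" "p < 2"
    and int: "integrable M (\<lambda>\<omega>. \<bar>Z \<omega>\<bar> powr p)"
  shows "(\<integral>\<^sup>+v. char_defect M Z v * ennreal (v powr (- p - 1)) * indicator {0<..} v \<partial>lborel) < \<infinity>"
proof -
  interpret P: pair_sigma_finite M lborel ..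
  define K where "K = 2 * (1 / (2 - p) + 1 / p)"
  have inner: "(\<integral>\<^sup>+v. ennreal (1 - cos (v * z)) * ennreal (v powr (- p - 1)) * indicator {0<..} v \<partial>lborel)
      \<le> ennreal (K * \<bar>z\<bar> powr p)" for z :: real
  proof (cases "z = 0")
    case False
    have "(\<integral>\<^sup>+v. ennreal (1 - cos (v * z)) * ennreal (v powr (- p - 1)) * indicator {0<..} v \<partial>lborel)
        \<le> (\<integral>\<^sup>+v. 2 * (ennreal (min ((\<bar>z\<bar> * v) powr 2) ((\<bar>z\<bar> * v) powr 0) * v powr (- p - 1)) * indicator {0<..} v) \<partial>lborel)"
    proof (intro nn_integral_mono)
      fix v :: real
      show "ennreal (1 - cos (v * z)) * ennreal (v powr (- p - 1)) * indicator {0<..} v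
        \<le> 2 * (ennreal (min ((\<bar>z\<bar> * v) powr 2) ((\<bar>z\<bar> * v) powr 0) * v powr (- p - 1)) * indicator {0<..} v)"
      proof (cases "0 < v")
        case True
        have "1 - cos (v * z) \<le> 2 * min ((\<bar>z\<bar> * v) powr 2) ((\<bar>z\<bar> * v) powr 0)"
          using one_minus_cos_le[of "v * z"] True by (simp add: abs_mult mult.commute)
        then have "(1 - cos (v * z)) * v powr (- p - 1)
            \<le> 2 * (min ((\<bar>z\<bar> * v) powr 2) ((\<bar>z\<bar> * v) powr 0) * v powr (- p - 1))"
          by (subst mult.assoc[symmetric]) (intro mult_right_mono, auto)
        then have "ennreal ((1 - cos (v * z)) * v powr (- p - 1))
            \<le> ennreal (2 * (min ((\<bar>z\<bar> * v) powr 2) ((\<bar>z\<bar> * v) powr 0) * v powr (- p - 1)))"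
          by (rule ennreal_leI)
        then show ?thesis
          using True by (simp add: ennreal_mult' ennreal_mult'' flip: ennreal_numeral)
      qed simp
    qed
    also have "\<dots> = 2 * (\<integral>\<^sup>+v. ennreal (min ((\<bar>z\<bar> * v) powr 2) ((\<bar>z\<bar> * v) powr 0) * v powr (- p - 1)) * indicator {0<..} v \<partial>lborel)"
      by (intro nn_integral_cmult) measurable
    also have "\<dots> \<le> 2 * ennreal (\<bar>z\<bar> powr p * (1 / (2 - p) + 1 / (p - 0)))"
      using p False by (intro mult_left_mono nn_integral_truncated_power) auto
    also have "\<dots> = ennreal (K * \<bar>z\<bar> powr p)"
      unfolding K_def by (subst ennreal_numeral[symmetric], subst ennreal_mult'[symmetric]) (auto simp: algebra_simps)
    finally show ?thesis .
  qed simp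
  have "(\<integral>\<^sup>+v. char_defect M Z v * ennreal (v powr (- p - 1)) * indicator {0<..} v \<partial>lborel)
      = (\<integral>\<^sup>+v. (\<integral>\<^sup>+\<omega>. ennreal (1 - cos (v * Z \<omega>)) * ennreal (v powr (- p - 1)) * indicator {0<..} v \<partial>M) \<partial>lborel)"
    unfolding char_defect_def by (intro nn_integral_cong) (simp add: nn_integral_multc)
  also have "\<dots> = (\<integral>\<^sup>+\<omega>. (\<integral>\<^sup>+v. ennreal (1 - cos (v * Z \<omega>)) * ennreal (v powr (- p - 1)) * indicator {0<..} v \<partial>lborel) \<partial>M)"
    by (intro P.Fubini') measurable
  also have "\<dots> \<le> (\<integral>\<^sup>+\<omega>. ennreal (K * \<bar>Z \<omega>\<bar> powr p) \<partial>M)"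
    by (intro nn_integral_mono inner)
  also have "\<dots> = ennreal (LINT \<omega>|M. K * \<bar>Z \<omega>\<bar> powr p)"
    using p int by (intro nn_integral_eq_integral) (auto simp: K_def)
  also have "\<dots> < \<infinity>" by simp
  finally show ?thesis .
qed

text \<open>
  Layer-cake formula for the moment of \<open>G\<close>, followed by Tonelli in \<open>(y, v)\<close> over the
  region \<open>v y \<le> 4\<close>.
\<close>
lemma (in prob_space) moment_le_of_tail:
  fixes G :: "'a \<Rightarrow> real" and h :: "real \<Rightarrow> ennreal"
  assumes G [measurable]: "random_variable borel G" and G_nonneg: "\<And>\<omega>. 0 \<le> G \<omega>" and p: "0 < p"
    and h [measurable]: "h \<in> borel_measurable borel"
    and tail: "\<And>x. 0 < x \<Longrightarrow> emeasure M {\<omega> \<in> space M. 2 * x \<le> G \<omega>}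
       \<le> 2 * (ennreal x * (\<integral>\<^sup>+v. h v * indicator {0<..2 / x} v \<partial>lborel))"
  shows "(\<integral>\<^sup>+\<omega>. ennreal (G \<omega> powr p) \<partial>M)
    \<le> ennreal (4 powr (p + 1)) * (\<integral>\<^sup>+v. h v * ennreal (v powr (- p - 1)) * indicator {0<..} v \<partial>lborel)"
proof -
  interpret P: pair_sigma_finite M lborel ..
  have pow: "ennreal (g powr p) = (\<integral>\<^sup>+y. ennreal (p * y powr (p - 1)) * indicator {0<..g} y \<partial>lborel)"
    if "0 \<le> g" for g :: real
  proof -
    have "(\<integral>\<^sup>+y. ennreal (p * y powr (p - 1)) * indicator {0<..g} y \<partial>lborel)
        = ennreal p * (\<integral>\<^sup>+y. ennreal (y powr (p - 1)) * indicator {0<..g} y \<partial>lborel)"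
      using p by (subst nn_integral_cmult[symmetric]) (auto simp: ennreal_mult' mult.assoc)
    also have "\<dots> = ennreal (g powr p)"
      using p that nn_integral_powr_from_0[of "p - 1" g] by (simp add: ennreal_mult'[symmetric])
    finally show ?thesis ..
  qed
  have tail': "emeasure M {\<omega> \<in> space M. y \<le> G \<omega>} \<le> ennreal y * (\<integral>\<^sup>+v. h v * indicator {0<..4 / y} v \<partial>lborel)"
    if "0 < y" for y
    using tail[of "y / 2"] that
    by (simp add: mult.assoc[symmetric] ennreal_numeral[symmetric] ennreal_mult'[symmetric] del: ennreal_numeral)
  have "(\<integral>\<^sup>+\<omega>. ennreal (G \<omega> powr p) \<partial>M)
      = (\<integral>\<^sup>+\<omega>. (\<integral>\<^sup>+y. ennreal (p * y powr (p - 1)) * indicator {0<..G \<omega>} y \<partial>lborel) \<partial>M)"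
    by (intro nn_integral_cong pow G_nonneg)
  also have "\<dots> = (\<integral>\<^sup>+\<omega>. (\<integral>\<^sup>+y. ennreal (p * y powr (p - 1)) * indicator {0<..} y * indicator {..G \<omega>} y \<partial>lborel) \<partial>M)"
    by (intro nn_integral_cong) (auto simp: indicator_def)
  also have "\<dots> = (\<integral>\<^sup>+y. (\<integral>\<^sup>+\<omega>. ennreal (p * y powr (p - 1)) * indicator {0<..} y * indicator {..G \<omega>} y \<partial>M) \<partial>lborel)"
    by (intro P.Fubini'[symmetric]) (simp add: indicator_def, measurable)
  also have "\<dots> = (\<integral>\<^sup>+y. ennreal (p * y powr (p - 1)) * indicator {0<..} y * emeasure M {\<omega> \<in> space M. y \<le> G \<omega>} \<partial>lborel)"
    by (intro nn_integral_cong, subst nn_integral_cmult)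
       (auto simp: indicator_def nn_integral_indicator[symmetric] simp del: nn_integral_indicator intro!: arg_cong2[where f="(*)"] nn_integral_cong)
  also have "\<dots> \<le> (\<integral>\<^sup>+y. ennreal (p * y powr (p - 1)) * indicator {0<..} y * (ennreal y * (\<integral>\<^sup>+v. h v * indicator {0<..4 / y} v \<partial>lborel)) \<partial>lborel)"
    using tail' by (intro nn_integral_mono) (auto simp: indicator_def intro!: mult_left_mono)
  also have "\<dots> = (\<integral>\<^sup>+y. (\<integral>\<^sup>+v. h v * indicator {0<..} v * (ennreal (p * y powr p) * indicator {0<..4 / v} y) \<partial>lborel) \<partial>lborel)"
  proof (intro nn_integral_cong)
    fix y :: real
    show "ennreal (p * y powr (p - 1)) * indicator {0<..} y * (ennreal y * (\<integral>\<^sup>+v. h v * indicator {0<..4 / y} v \<partial>lborel))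
      = (\<integral>\<^sup>+v. h v * indicator {0<..} v * (ennreal (p * y powr p) * indicator {0<..4 / v} y) \<partial>lborel)"
    proof (cases "0 < y")
      case True
      have "ennreal (p * y powr (p - 1)) * (ennreal y * (\<integral>\<^sup>+v. h v * indicator {0<..4 / y} v \<partial>lborel))
        = ennreal (p * y powr p) * (\<integral>\<^sup>+v. h v * indicator {0<..4 / y} v \<partial>lborel)"
        using True p by (simp add: mult.assoc[symmetric] ennreal_mult'[symmetric] powr_diff)
      also have "\<dots> = (\<integral>\<^sup>+v. ennreal (p * y powr p) * (h v * indicator {0<..4 / y} v) \<partial>lborel)"
        by (intro nn_integral_cmult[symmetric]) measurable
      also have "\<dots> = (\<integral>\<^sup>+v. h v * indicator {0<..} v * (ennreal (p * y powr p) * indicator {0<..4 / v} y) \<partial>lborel)"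
        using True by (intro nn_integral_cong) (auto simp: indicator_def field_simps)
      finally show ?thesis using True by simp
    next
      case False
      then show ?thesis by simp
    qed
  qed
  also have "\<dots> = (\<integral>\<^sup>+v. (\<integral>\<^sup>+y. h v * indicator {0<..} v * (ennreal (p * y powr p) * indicator {0<..4 / v} y) \<partial>lborel) \<partial>lborel)"
    by (intro lborel_pair.Fubini'[symmetric]) (simp add: indicator_def, measurable)
  also have "\<dots> = (\<integral>\<^sup>+v. h v * indicator {0<..} v * ennreal (p / (p + 1) * (4 / v) powr (p + 1)) \<partial>lborel)"
  proof (intro nn_integral_cong)
    fix v :: real
    show "(\<integral>\<^sup>+y. h v * indicator {0<..} v * (ennreal (p * y powr p) * indicator {0<..4 / v} y) \<partial>lborel)
      = h v * indicator {0<..} v * ennreal (p / (p + 1) * (4 / v) powr (p + 1))"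
    proof (cases "0 < v")
      case True
      have "(\<integral>\<^sup>+y. ennreal (p * y powr p) * indicator {0<..4 / v} y \<partial>lborel)
          = ennreal p * (\<integral>\<^sup>+y. ennreal (y powr p) * indicator {0<..4 / v} y \<partial>lborel)"
        using p by (subst nn_integral_cmult[symmetric]) (auto simp: ennreal_mult' mult.assoc)
      also have "\<dots> = ennreal (p / (p + 1) * (4 / v) powr (p + 1))"
        using p True by (simp add: nn_integral_powr_from_0 ennreal_mult'[symmetric])
      finally show ?thesis by (subst nn_integral_cmult) auto
    qed simp
  qed
  also have "\<dots> \<le> (\<integral>\<^sup>+v. ennreal (4 powr (p + 1)) * (h v * ennreal (v powr (- p - 1)) * indicator {0<..} v) \<partial>lborel)"
  proof (intro nn_integral_mono)
    fix v :: real
    show "h v * indicator {0<..} v * ennreal (p / (p + 1) * (4 / v) powr (p + 1))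
      \<le> ennreal (4 powr (p + 1)) * (h v * ennreal (v powr (- p - 1)) * indicator {0<..} v)"
    proof (cases "0 < v")
      case True
      have "p / (p + 1) * (4 / v) powr (p + 1) \<le> 1 * (4 / v) powr (p + 1)"
        using p by (intro mult_right_mono) auto
      also have "\<dots> = 4 powr (p + 1) * v powr (- p - 1)"
        using True powr_minus_divide[of v "p + 1"] by (simp add: powr_divide)
      finally have "h v * ennreal (p / (p + 1) * (4 / v) powr (p + 1)) \<le> h v * ennreal (4 powr (p + 1) * v powr (- p - 1))"
        by (intro mult_left_mono ennreal_leI) auto
      then show ?thesis using True by (simp add: ennreal_mult' mult_ac)
    qed simp
  qed
  also have "\<dots> = ennreal (4 powr (p + 1)) * (\<integral>\<^sup>+v. h v * ennreal (v powr (- p - 1)) * indicator {0<..} v \<partial>lborel)"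
    by (intro nn_integral_cmult) measurable
  finally show ?thesis .
qed

section \<open>The supremum of a Levy process\<close>

text \<open>
  At the first time \<open>k\<close> with \<open>\<bar>S k\<bar> \<ge> 2 x\<close>, the remaining increment \<open>S n - S k\<close> is independent
  of the past and smaller than \<open>x\<close> with probability at least \<open>1 - q\<close>, in which case \<open>\<bar>S n\<bar> \<ge> x\<close>.
  So the event below has probability at most \<open>q / (1 - q)\<close>, and \<open>2 q\<close> is a bound both for
  \<open>q \<le> 1/2\<close> and, trivially, for \<open>q > 1/2\<close>.
\<close>
lemma (in prob_space) ottaviani_inequality:
  fixes \<xi> :: "nat \<Rightarrow> 'a \<Rightarrow> real"
  assumes indep: "indep_vars (\<lambda>_. borel) \<xi> {..<n}" and x: "0 < x"
    and q: "\<And>k. k \<le> n \<Longrightarrow> prob {\<omega> \<in> space M. x \<le> \<bar>\<Sum>i\<in>{k..<n}. \<xi> i \<omega>\<bar>} \<le> q"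
  shows "prob {\<omega> \<in> space M. \<exists>k\<le>n. 2 * x \<le> \<bar>\<Sum>i<k. \<xi> i \<omega>\<bar>} \<le> 2 * q"
proof (cases "q \<le> 1 / 2")
  case False
  then show ?thesis by (intro order_trans[OF prob_le_1]) simp
next
  case True
  have \<xi> [measurable]: "random_variable borel (\<xi> i)" if "i < n" for i
    using indep that by (auto simp: indep_vars_def)
  define A where "A k = {\<omega> \<in> space M. (\<forall>j\<in>{..<k}. \<bar>\<Sum>i<j. \<xi> i \<omega>\<bar> < 2 * x) \<and> 2 * x \<le> \<bar>\<Sum>i<k. \<xi> i \<omega>\<bar>}" for k
  define B where "B k = {\<omega> \<in> space M. \<bar>\<Sum>i\<in>{k..<n}. \<xi> i \<omega>\<bar> < x}" for k
  have S [measurable]: "(\<lambda>\<omega>. \<Sum>i<j. \<xi> i \<omega>) \<in> borel_measurable M" if "j \<le> n" for j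
    using that by (intro borel_measurable_sum \<xi>) auto
  have R [measurable]: "(\<lambda>\<omega>. \<Sum>i\<in>{k..<n}. \<xi> i \<omega>) \<in> borel_measurable M" for k
    by (intro borel_measurable_sum \<xi>) auto
  have A_sets: "A k \<in> events" if "k \<le> n" for k
  proof -
    have [measurable]: "(\<lambda>\<omega>. \<Sum>i<j. \<xi> i \<omega>) \<in> borel_measurable M" if "j \<in> {..<k}" for j
      using that \<open>k \<le> n\<close> by (intro S) auto
    have [measurable]: "(\<lambda>\<omega>. \<Sum>i<k. \<xi> i \<omega>) \<in> borel_measurable M"
      using \<open>k \<le> n\<close> by (rule S)
    show ?thesis unfolding A_def by measurable
  qed
  have B_sets: "B k \<in> events" for k
    unfolding B_def by measurable
  have AB: "prob (A k \<inter> B k) = prob (A k) * prob (B k)" if k: "k \<le> n" for k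
  proof -
    let ?P = "PiM {..<k} (\<lambda>_. borel :: real measure)" and ?Q = "PiM {k..<n} (\<lambda>_. borel :: real measure)"
    define XA where "XA = {f \<in> space ?P. (\<forall>j\<in>{..<k}. \<bar>\<Sum>i<j. f i\<bar> < 2 * x) \<and> 2 * x \<le> \<bar>\<Sum>i<k. f i\<bar>}"
    define XB where "XB = {f \<in> space ?Q. \<bar>\<Sum>i\<in>{k..<n}. f i\<bar> < x}"
    have P: "(\<lambda>f. \<Sum>i<j. f i) \<in> borel_measurable ?P" if "j \<le> k" for j
      using that by (intro borel_measurable_sum measurable_component_singleton) auto
    have [measurable]: "(\<lambda>f. \<Sum>i<k. f i) \<in> borel_measurable ?P"
      by (rule P) simp
    have [measurable]: "(\<lambda>f. \<Sum>i<j. f i) \<in> borel_measurable ?P" if "j \<in> {..<k}" for j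
      using that by (intro P) auto
    have [measurable]: "(\<lambda>f. \<Sum>i\<in>{k..<n}. f i) \<in> borel_measurable ?Q"
      by (intro borel_measurable_sum measurable_component_singleton) auto
    have "XA \<in> sets ?P" "XB \<in> sets ?Q"
      unfolding XA_def XB_def by measurable
    moreover have "indep_var ?P (\<lambda>\<omega>. restrict (\<lambda>i. \<xi> i \<omega>) {..<k}) ?Q (\<lambda>\<omega>. restrict (\<lambda>i. \<xi> i \<omega>) {k..<n})"
      using k by (intro indep_var_restrict[OF indep]) auto
    ultimately have "prob ((\<lambda>\<omega>. (restrict (\<lambda>i. \<xi> i \<omega>) {..<k}, restrict (\<lambda>i. \<xi> i \<omega>) {k..<n})) -` (XA \<times> XB) \<inter> space M)
      = prob ((\<lambda>\<omega>. restrict (\<lambda>i. \<xi> i \<omega>) {..<k}) -` XA \<inter> space M) * prob ((\<lambda>\<omega>. restrict (\<lambda>i. \<xi> i \<omega>) {k..<n}) -` XB \<inter> space M)"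
      by (intro indep_varD) 
    moreover have A': "(\<lambda>\<omega>. restrict (\<lambda>i. \<xi> i \<omega>) {..<k}) -` XA \<inter> space M = A k"
      by (auto simp: A_def XA_def space_PiM)
    moreover have B': "(\<lambda>\<omega>. restrict (\<lambda>i. \<xi> i \<omega>) {k..<n}) -` XB \<inter> space M = B k"
      by (auto simp: B_def XB_def space_PiM)
    moreover have "(\<lambda>\<omega>. (restrict (\<lambda>i. \<xi> i \<omega>) {..<k}, restrict (\<lambda>i. \<xi> i \<omega>) {k..<n})) -` (XA \<times> XB) \<inter> space M = A k \<inter> B k"
      unfolding A'[symmetric] B'[symmetric] by auto
    ultimately show ?thesis by simp
  qed
  have half: "prob (A k) \<le> 2 * prob (A k \<inter> B k)" if k: "k \<le> n" for k
  proof -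
    have "space M - B k = {\<omega> \<in> space M. x \<le> \<bar>\<Sum>i\<in>{k..<n}. \<xi> i \<omega>\<bar>}"
      by (auto simp: B_def)
    then have "1 / 2 \<le> prob (B k)"
      using q[OF k] True prob_compl[OF B_sets, of k] by simp
    then have "prob (A k) * (1 / 2) \<le> prob (A k) * prob (B k)"
      by (intro mult_left_mono) auto
    then show ?thesis using AB[OF k] by simp
  qed
  have disj: "disjoint_family_on A {..n}"
    unfolding disjoint_family_on_def
  proof safe
    fix j k \<omega> assume "j \<noteq> k" "\<omega> \<in> A j" "\<omega> \<in> A k"
    then show "\<omega> \<in> {}"
      by (cases j k rule: linorder_cases) (force simp: A_def)+
  qed
  have "{\<omega> \<in> space M. \<exists>k\<le>n. 2 * x \<le> \<bar>\<Sum>i<k. \<xi> i \<omega>\<bar>} = (\<Union>k\<in>{..n}. A k)"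
  proof (intro set_eqI iffI)
    fix \<omega> assume *: "\<omega> \<in> {\<omega> \<in> space M. \<exists>k\<le>n. 2 * x \<le> \<bar>\<Sum>i<k. \<xi> i \<omega>\<bar>}"
    define k where "k = (LEAST k. 2 * x \<le> \<bar>\<Sum>i<k. \<xi> i \<omega>\<bar>)"
    obtain l where l: "l \<le> n" "2 * x \<le> \<bar>\<Sum>i<l. \<xi> i \<omega>\<bar>" using * by auto
    have "2 * x \<le> \<bar>\<Sum>i<k. \<xi> i \<omega>\<bar>" "k \<le> l" "\<And>j. j < k \<Longrightarrow> \<not> 2 * x \<le> \<bar>\<Sum>i<j. \<xi> i \<omega>\<bar>"
      unfolding k_def using l by (auto intro: LeastI Least_le dest: not_less_Least)
    then show "\<omega> \<in> (\<Union>k\<in>{..n}. A k)"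
      using * l by (auto simp: A_def not_le intro!: bexI[of _ k])
  qed (auto simp: A_def)
  then have "prob {\<omega> \<in> space M. \<exists>k\<le>n. 2 * x \<le> \<bar>\<Sum>i<k. \<xi> i \<omega>\<bar>} = (\<Sum>k\<le>n. prob (A k))"
    using disj A_sets by (simp add: finite_measure_finite_Union image_subset_iff)
  also have "\<dots> \<le> (\<Sum>k\<le>n. 2 * prob (A k \<inter> B k))"
    by (intro sum_mono half) auto
  also have "\<dots> = 2 * prob (\<Union>k\<in>{..n}. A k \<inter> B k)"
    using disj A_sets B_sets
    by (subst finite_measure_finite_Union)
       (auto simp: sum_distrib_left disjoint_family_on_def)
  also have "prob (\<Union>k\<in>{..n}. A k \<inter> B k) \<le> prob {\<omega> \<in> space M. x \<le> \<bar>\<Sum>i\<in>{0..<n}. \<xi> i \<omega>\<bar>}"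
  proof (rule finite_measure_mono)
    show "(\<Union>k\<in>{..n}. A k \<inter> B k) \<subseteq> {\<omega> \<in> space M. x \<le> \<bar>\<Sum>i\<in>{0..<n}. \<xi> i \<omega>\<bar>}"
    proof safe
      fix k \<omega> assume k: "k \<le> n" and \<omega>: "\<omega> \<in> A k" "\<omega> \<in> B k"
      have "(\<Sum>i\<in>{0..<n}. \<xi> i \<omega>) = (\<Sum>i<k. \<xi> i \<omega>) + (\<Sum>i\<in>{k..<n}. \<xi> i \<omega>)"
        using k sum.atLeastLessThan_concat[of 0 k n "\<lambda>i. \<xi> i \<omega>"] by (simp add: lessThan_atLeast0)
      then show "x \<le> \<bar>\<Sum>i\<in>{0..<n}. \<xi> i \<omega>\<bar>" 
        using \<omega> by (auto simp: A_def B_def)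
    qed (auto simp: A_def)
  qed measurable
  also have "\<dots> \<le> q" by (rule q) simp
  finally show ?thesis by simp
qed

text \<open>
  For \<open>s < t\<close> the first point of the \<open>m\<close>-th dyadic grid of \<open>[0, t]\<close> strictly to the right of \<open>s\<close> tends to \<open>s\<close>
  from the right as \<open>m\<close> grows; the endpoint \<open>t\<close>, which cannot be approached from the right within
  \<open>[0, t]\<close>, belongs to every grid.
\<close>
lemma SUP_le_dyadic_SUP:
  fixes f :: "real \<Rightarrow> real" and t p :: real
  assumes t: "0 < t" and p: "0 < p"
    and right: "\<And>s. 0 \<le> s \<Longrightarrow> (f \<longlongrightarrow> f s) (at_right s)"
    and bound: "\<And>m k. k \<le> 2 ^ m \<Longrightarrow> ennreal (\<bar>f (t * real k / 2 ^ m)\<bar> powr p) \<le> B"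
  shows "(SUP s\<in>{0..t}. ennreal (\<bar>f s\<bar> powr p)) \<le> B"
proof (rule SUP_least)
  fix s assume s: "s \<in> {0..t}"
  show "ennreal (\<bar>f s\<bar> powr p) \<le> B"
  proof (cases "s = t")
    case True
    then show ?thesis using bound[of 1 0] by simp
  next
    case False
    define k where "k m = nat \<lfloor>s * 2 ^ m / t\<rfloor> + 1" for m :: nat
    define r where "r m = t * real (k m) / 2 ^ m" for m
    have k_real: "real (k m) = of_int \<lfloor>s * 2 ^ m / t\<rfloor> + 1" for m
      using s t by (simp add: k_def)
    have lower: "s < r m" for m
    proof -
      have "s * 2 ^ m / t < real (k m)" unfolding k_real by linarith
      then show ?thesis using t by (simp add: r_def field_simps)
    qed
    have upper: "r m \<le> s + t * (1 / 2) ^ m" for m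
    proof -
      have "real (k m) \<le> s * 2 ^ m / t + 1" unfolding k_real by linarith
      then show ?thesis using t by (simp add: r_def field_simps power_one_over)
    qed
    have le: "k m \<le> 2 ^ m" for m
    proof -
      have "s * 2 ^ m / t < 2 ^ m" using s False t by (simp add: field_simps)
      then have "\<lfloor>s * 2 ^ m / t\<rfloor> < 2 ^ m" by (simp add: floor_less_iff)
      then show ?thesis using s t unfolding k_def by (simp add: nat_less_iff Suc_le_eq)
    qed
    have "(\<lambda>m. s + t * (1 / 2) ^ m) \<longlonglongrightarrow> s + t * 0"
      by (intro tendsto_intros LIMSEQ_power_zero) simp
    then have "r \<longlonglongrightarrow> s"
      by (intro tendsto_sandwich[OF _ _ tendsto_const, of s r _ "\<lambda>m. s + t * (1 / 2) ^ m"])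
         (auto intro!: always_eventually less_imp_le lower upper)
    then have "filterlim r (at_right s) sequentially"
      using less_imp_neq[OF lower] by (auto simp: filterlim_at lower intro!: always_eventually) 
    then have "(\<lambda>m. f (r m)) \<longlonglongrightarrow> f s"
      using s by (intro filterlim_compose[OF right]) auto
    then have "(\<lambda>m. ennreal (\<bar>f (r m)\<bar> powr p)) \<longlonglongrightarrow> ennreal (\<bar>f s\<bar> powr p)"
      using p by (intro tendsto_ennrealI tendsto_powr' tendsto_rabs tendsto_const) auto
    then show ?thesis
      by (rule LIMSEQ_le_const2) (use bound[OF le] in \<open>auto simp: r_def\<close>)
  qed
qed

text \<open>
  Ottaviani's inequality on a dyadic grid has a bound that does not depend on the mesh, so the
  moment bound passes to the limit by monotone convergence.  By stationarity the remaining
  increment \<open>X t - X s\<close> has the law of \<open>X (t - s)\<close>, so only single values of the process occur.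
\<close>
lemma (in levy_process) sup_moment_le_char_defect:
  fixes h :: "real \<Rightarrow> ennreal" and p t :: real
  assumes t: "0 < t" and p: "0 < p"
    and h [measurable]: "h \<in> borel_measurable borel"
    and bound: "\<And>s v. 0 \<le> s \<Longrightarrow> s \<le> t \<Longrightarrow> 0 < v \<Longrightarrow> char_defect M (X s) v \<le> h v"
  shows "sup_moment M X p t
    \<le> ennreal (4 powr (p + 1)) * (\<integral>\<^sup>+v. h v * ennreal (v powr (- p - 1)) * indicator {0<..} v \<partial>lborel)"
proof -
  note X [measurable] = random_variable_X
  define \<tau> where "\<tau> m i = t * real i / 2 ^ m" for m i :: nat
  have \<tau>_nonneg: "0 \<le> \<tau> m i" for m i using t by (simp add: \<tau>_def)
  have \<tau>_mono: "\<tau> m i \<le> \<tau> m j" if "i \<le> j" for m i j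
    using t that by (simp add: \<tau>_def divide_right_mono)
  have \<tau>_end: "\<tau> m (2 ^ m) = t" for m by (simp add: \<tau>_def)
  have \<tau>_0: "\<tau> m 0 = 0" for m by (simp add: \<tau>_def)
  have \<tau>_refine: "\<tau> m i = \<tau> (Suc m) (2 * i)" for m i by (simp add: \<tau>_def)
  define G where "G m \<omega> = Max ((\<lambda>k. \<bar>X (\<tau> m k) \<omega> - X 0 \<omega>\<bar>) ` {..2 ^ m})" for m \<omega>
  have G_measurable [measurable]: "random_variable borel (G m)" for m
    unfolding G_def
    by (rule borel_measurable_Max) (auto intro!: borel_measurable_abs borel_measurable_diff X \<tau>_nonneg)
  have G_ge: "\<bar>X (\<tau> m k) \<omega> - X 0 \<omega>\<bar> \<le> G m \<omega>" if "k \<le> 2 ^ m" for m k \<omega>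
    unfolding G_def using that by (intro Max_ge) auto
  have G_nonneg: "0 \<le> G m \<omega>" for m \<omega>
    using G_ge[of 0 m \<omega>] by (simp add: \<tau>_0)
  have G_mono: "G m \<omega> \<le> G (Suc m) \<omega>" for m \<omega>
  proof -
    have "\<bar>X (\<tau> m k) \<omega> - X 0 \<omega>\<bar> \<le> G (Suc m) \<omega>" if "k \<le> 2 ^ m" for k
      using G_ge[of "2 * k" "Suc m" \<omega>] that by (simp only: \<tau>_refine[of m k, symmetric]) simp
    then show ?thesis
      unfolding G_def[of m] by (intro Max.boundedI) auto
  qed
  have tail: "emeasure M {\<omega> \<in> space M. 2 * x \<le> G m \<omega>}
       \<le> 2 * (ennreal x * (\<integral>\<^sup>+v. h v * indicator {0<..2 / x} v \<partial>lborel))" if x: "0 < x" for x m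
  proof -
    define Q where "Q = ennreal x * (\<integral>\<^sup>+v. h v * indicator {0<..2 / x} v \<partial>lborel)"
    show ?thesis
    proof (cases "Q = \<infinity>")
      case True
      then show ?thesis unfolding Q_def[symmetric] by (simp add: ennreal_mult_top)
    next
      case False
      then obtain q where q: "Q = ennreal q" "0 \<le> q" by (cases Q) auto
      define \<xi> where "\<xi> i \<omega> = X (\<tau> m (Suc i)) \<omega> - X (\<tau> m i) \<omega>" for i \<omega>
      have indep: "indep_vars (\<lambda>_. borel) \<xi> {..<2 ^ m}"
        unfolding \<xi>_def by (rule indep_increments) (auto intro: \<tau>_nonneg \<tau>_mono)
      have head: "(\<Sum>i<k. \<xi> i \<omega>) = X (\<tau> m k) \<omega> - X 0 \<omega>" for k \<omega>
        unfolding \<xi>_def by (subst sum_lessThan_telescope) (simp add: \<tau>_0)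
      have rest: "(\<Sum>i\<in>{k..<2 ^ m}. \<xi> i \<omega>) = X t \<omega> - X (\<tau> m k) \<omega>" if "k \<le> 2 ^ m" for k \<omega>
        unfolding \<xi>_def using that by (subst sum_Suc_diff') (auto simp: \<tau>_end)
      have "prob {\<omega> \<in> space M. x \<le> \<bar>\<Sum>i\<in>{k..<2 ^ m}. \<xi> i \<omega>\<bar>} \<le> q" if k: "k \<le> 2 ^ m" for k
      proof -
        define s where "s = \<tau> m k"
        have s: "0 \<le> s" "s \<le> t" using \<tau>_nonneg \<tau>_mono[OF k, of m] by (auto simp: s_def \<tau>_end)
        have [measurable]: "random_variable borel (X t)" "random_variable borel (X s)" "random_variable borel (X (t - s))"
          using s t by auto
        have "emeasure M {\<omega> \<in> space M. x \<le> \<bar>X t \<omega> - X s \<omega>\<bar>}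
            = emeasure (distr M borel (\<lambda>\<omega>. X (s + (t - s)) \<omega> - X s \<omega>)) {y. x \<le> \<bar>y\<bar>}"
          by (subst emeasure_distr) (auto intro!: arg_cong[where f="emeasure M"])
        also have "\<dots> = emeasure (distr M borel (X (t - s))) {y. x \<le> \<bar>y\<bar>}"
          using s by (subst stationary_increments) auto
        also have "\<dots> = emeasure M {\<omega> \<in> space M. x \<le> \<bar>X (t - s) \<omega>\<bar>}"
          by (subst emeasure_distr) (auto intro!: arg_cong[where f="emeasure M"])
        also have "\<dots> \<le> ennreal x * (\<integral>\<^sup>+v. char_defect M (X (t - s)) v * indicator {0<..2 / x} v \<partial>lborel)"
          using x by (intro tail_le_char_defect) auto
        also have "\<dots> \<le> Q"
          unfolding Q_def using s bound[of "t - s"]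
          by (intro mult_left_mono nn_integral_mono) (auto simp: indicator_def)
        finally show ?thesis
          unfolding rest[OF k] s_def[symmetric] using q by (simp add: emeasure_eq_measure)
      qed
      then have "prob {\<omega> \<in> space M. \<exists>k\<le>2 ^ m. 2 * x \<le> \<bar>\<Sum>i<k. \<xi> i \<omega>\<bar>} \<le> 2 * q"
        by (rule ottaviani_inequality[OF indep x])
      moreover have "{\<omega> \<in> space M. 2 * x \<le> G m \<omega>} = {\<omega> \<in> space M. \<exists>k\<le>2 ^ m. 2 * x \<le> \<bar>\<Sum>i<k. \<xi> i \<omega>\<bar>}"
        unfolding head G_def by (auto simp: Max_ge_iff)
      ultimately show ?thesis
        unfolding Q_def[symmetric] q(1) using q(2)
        by (simp add: emeasure_eq_measure ennreal_mult'[symmetric] flip: ennreal_numeral)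
    qed
  qed
  have "AE \<omega> in M. (SUP s\<in>{0..t}. ennreal (\<bar>X s \<omega>\<bar> powr p)) \<le> (SUP m. ennreal (G m \<omega> powr p))"
    using X_zero cadlag_paths
  proof eventually_elim
    case (elim \<omega>)
    show ?case
    proof (rule SUP_le_dyadic_SUP[OF t p])
      show "((\<lambda>t. X t \<omega>) \<longlongrightarrow> X s \<omega>) (at_right s)" if "0 \<le> s" for s
        using elim(2) that by (auto simp: cadlag_def)
      show "ennreal (\<bar>X (t * real k / 2 ^ m) \<omega>\<bar> powr p) \<le> (SUP m. ennreal (G m \<omega> powr p))"
        if "k \<le> 2 ^ m" for m k
        using G_ge[OF that, of \<omega>] elim(1) p
        by (intro SUP_upper2[of m] ennreal_leI powr_mono2) (auto simp: \<tau>_def)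
    qed
  qed
  then have "sup_moment M X p t \<le> (\<integral>\<^sup>+\<omega>. (SUP m. ennreal (G m \<omega> powr p)) \<partial>M)"
    unfolding sup_moment_def by (rule nn_integral_mono_AE)
  also have "\<dots> = (SUP m. \<integral>\<^sup>+\<omega>. ennreal (G m \<omega> powr p) \<partial>M)"
    using p by (intro nn_integral_monotone_convergence_SUP)
       (auto intro!: incseq_SucI le_funI ennreal_leI powr_mono2 G_mono G_nonneg)
  also have "\<dots> \<le> ennreal (4 powr (p + 1)) * (\<integral>\<^sup>+v. h v * ennreal (v powr (- p - 1)) * indicator {0<..} v \<partial>lborel)"
    by (intro SUP_least moment_le_of_tail G_measurable G_nonneg p h tail)
  finally show ?thesis .
qed

section \<open>From bounds on the characteristic exponent to moment bounds\<close>

lemma one_minus_Re_exp_le: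
  fixes z :: complex and s :: real
  assumes "0 \<le> s" "0 \<le> Re z"
  shows "1 - Re (exp (- of_real s * z)) \<le> s * Re z + (s * Im z)\<^sup>2"
proof -
  define e where "e = exp (- (s * Re z))"
  have e: "1 - s * Re z \<le> e" "0 \<le> e" "e \<le> 1"
    using exp_ge_add_one_self[of "- (s * Re z)"] assms by (auto simp: e_def)
  have "1 - Re (exp (- of_real s * z)) = (1 - e) + e * (1 - cos (s * Im z))"
    by (simp add: Re_exp e_def algebra_simps)
  also have "e * (1 - cos (s * Im z)) \<le> 1 * (1 - cos (s * Im z))"
    using e by (intro mult_right_mono) auto
  also have "1 * (1 - cos (s * Im z)) \<le> (s * Im z)\<^sup>2"
    using one_minus_cos_le_square[of "s * Im z"] zero_le_power2[of "s * Im z"] unfolding mult_1 by linarith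
  finally show ?thesis using e by linarith
qed

lemma one_minus_cos_ge_square:
  fixes y :: real
  assumes "\<bar>y\<bar> \<le> 1"
  shows "y\<^sup>2 / 3 \<le> 1 - cos y"
proof -
  have "cmod (iexp y - (\<Sum>k\<le>2. (\<i> * y) ^ k / fact k)) \<le> \<bar>y\<bar> ^ Suc 2 / fact (Suc 2)"
    by (rule iexp_approx1)
  moreover have "\<bar>Re (iexp y - (\<Sum>k\<le>2. (\<i> * y) ^ k / fact k))\<bar> \<le> cmod (iexp y - (\<Sum>k\<le>2. (\<i> * y) ^ k / fact k))"
    by (rule abs_Re_le_cmod)
  moreover have "Re (iexp y - (\<Sum>k\<le>2. (\<i> * y) ^ k / fact k)) = cos y - 1 + y\<^sup>2 / 2"
    by (simp add: Re_exp numeral_2_eq_2 power2_eq_square)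
  moreover have "\<bar>y\<bar> ^ Suc 2 / fact (Suc 2) \<le> y\<^sup>2 / 6"
    using mult_right_mono[OF assms, of "y\<^sup>2"] by (simp add: fact_numeral power2_eq_square power3_eq_cube)
  ultimately show ?thesis by linarith
qed

text \<open>
  For \<open>cmod z \<le> 1\<close>, which excludes the zeros of \<open>1 - cos (Im z)\<close> other than 0, the quantity
  \<open>1 - Re (exp (- z))\<close> is comparable to \<open>Re z + (Im z)\<^sup>2\<close>, and \<open>1 - Re (exp (- s z))\<close> is at most \<open>s\<close> times that sum.
  This is how a moment at time 1 controls the process at all times \<open>s \<le> t\<close>, with a factor \<open>t\<close>.
\<close>
lemma one_minus_Re_exp_compare:
  fixes z :: complex and s t :: real
  assumes s: "0 \<le> s" "s \<le> t" "t \<le> 1" and z: "0 \<le> Re z" "cmod z \<le> 1"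
  shows "1 - Re (exp (- of_real s * z)) \<le> 10 * t * (1 - Re (exp (- z)))"
proof -
  have R: "Re z \<le> 1" and I: "\<bar>Im z\<bar> \<le> 1"
    using z abs_Re_le_cmod[of z] abs_Im_le_cmod[of z] by auto
  define e where "e = exp (- Re z)"
  have e1: "1 / 3 \<le> e"
  proof -
    have "exp (- 1) \<le> e" using R by (simp add: e_def)
    moreover have "(1::real) / 3 \<le> exp (- 1)"
      using exp_le by (simp add: exp_minus field_simps)
    ultimately show ?thesis by linarith
  qed
  have e2: "e \<le> 1 - Re z / 2"
  proof -
    have "1 + Re z \<le> exp (Re z)" by (rule exp_ge_add_one_self)
    then have "e * (1 + Re z) \<le> 1"
      using mult_left_mono[of "1 + Re z" "exp (Re z)" e] by (simp add: e_def exp_minus)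
    also have "1 \<le> (1 - Re z / 2) * (1 + Re z)"
    proof -
      have "0 \<le> Re z * (1 - Re z)" using z R by (intro mult_nonneg_nonneg) auto
      then show ?thesis by (simp add: algebra_simps)
    qed
    finally show ?thesis using z by (simp add: mult_le_cancel_right)
  qed
  have "(1 / 3) * ((Im z)\<^sup>2 / 3) \<le> e * (1 - cos (Im z))"
    using e1 one_minus_cos_ge_square[OF I] by (intro mult_mono) auto
  moreover have "1 - Re (exp (- z)) = (1 - e) + e * (1 - cos (Im z))"
    by (simp add: Re_exp e_def algebra_simps)
  ultimately have lower: "Re z / 2 + (Im z)\<^sup>2 / 9 \<le> 1 - Re (exp (- z))"
    using e2 by linarith
  have "(s * Im z)\<^sup>2 \<le> s * (Im z)\<^sup>2"
    using s mult_right_mono[of "s * s" s "(Im z)\<^sup>2"] mult_left_le[of s s]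
    by (simp add: power_mult_distrib power2_eq_square[of s])
  then have "1 - Re (exp (- of_real s * z)) \<le> s * (Re z + (Im z)\<^sup>2)"
    using one_minus_Re_exp_le[OF s(1) z(1)] by (simp add: distrib_left)
  \<comment> \<open>10 is an integer above the reciprocals of both coefficients in \<open>lower\<close>.\<close>
  also have "\<dots> \<le> t * (10 * (Re z / 2 + (Im z)\<^sup>2 / 9))"
    using s z zero_le_power2[of "Im z"]
    by (intro mult_mono) (simp_all add: field_simps del: zero_le_power2)
  also have "\<dots> \<le> t * (10 * (1 - Re (exp (- z))))"
    using s lower by (intro mult_left_mono) auto
  finally show ?thesis by (simp add: mult_ac)
qed

text \<open>
  The frequencies \<open>v\<close> are split at \<open>\<delta>\<close> and at a free parameter \<open>T\<close>: below \<open>\<delta>\<close> the moment of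
  \<open>X 1\<close> controls the integral, between \<open>\<delta>\<close> and \<open>T\<close> the bounds on the exponent do, and above \<open>T\<close> the
  trivial bound 2 does.  The bounds \<open>A\<close> and \<open>B\<close> on the real and imaginary parts are separate, and
  \<open>B\<close> may depend on \<open>t\<close>: for index 1 the imaginary part is larger by a logarithm, but it enters only
  quadratically.
\<close>
lemma (in levy_process) sup_moment_le_exponent:
  fixes \<Psi> :: "real \<Rightarrow> complex" and p \<beta> \<delta> :: real
  assumes exponent: "\<And>u s. 0 \<le> s \<Longrightarrow> (CLINT \<omega>|M. iexp (u * X s \<omega>)) = exp (- of_real s * \<Psi> u)"
    and \<delta>: "0 < \<delta>" and small: "\<And>v. 0 < v \<Longrightarrow> v \<le> \<delta> \<Longrightarrow> cmod (\<Psi> v) \<le> 1"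
    and p: "0 < p" "p < 2" "p \<le> \<beta>"
    and moment: "integrable M (\<lambda>\<omega>. \<bar>X 1 \<omega>\<bar> powr p)"
  shows "\<exists>K\<ge>0. \<forall>t T A B. 0 < t \<longrightarrow> t \<le> 1 \<longrightarrow> \<delta> \<le> T \<longrightarrow> 0 \<le> A \<longrightarrow>
      (\<forall>v. \<delta> < v \<longrightarrow> v \<le> T \<longrightarrow> Re (\<Psi> v) \<le> A * v powr \<beta> \<and> \<bar>Im (\<Psi> v)\<bar> \<le> B * v powr \<beta>) \<longrightarrow>
      sup_moment M X p t \<le> ennreal (K * (t + t * A * T powr (\<beta> - p) * ln (T / \<delta>)
        + (t * B)\<^sup>2 * T powr (2 * \<beta> - p) + T powr (- p)))"
proof -
  note X [measurable] = random_variable_X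
  have X1 [measurable]: "random_variable borel (X 1)" by (rule X) simp
  define I where "I = (\<integral>\<^sup>+v. char_defect M (X 1) v * ennreal (v powr (- p - 1)) * indicator {0<..} v \<partial>lborel)"
  have "I < \<infinity>"
    unfolding I_def using p by (intro char_defect_integral_finite X1 moment) auto
  then obtain D where D: "I = ennreal D" "0 \<le> D" by (cases I) auto
  define k where "k = 10 * D + 1 + 1 / (2 * \<beta> - p) + 2 / p"
  have k: "10 * D \<le> k" "1 \<le> k" "1 / (2 * \<beta> - p) \<le> k" "2 / p \<le> k" "0 \<le> k"
    using D p by (auto simp: k_def)
  have defect: "char_defect M (X s) v = ennreal (1 - Re (exp (- of_real s * \<Psi> v)))" if "0 \<le> s" for s v
    using that exponent[OF that, of v] by (simp only: char_defect_eq X)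
  have Re_nonneg: "0 \<le> Re (\<Psi> v)" for v
  proof -
    have "exp (- Re (\<Psi> v)) = cmod (CLINT \<omega>|M. iexp (v * X 1 \<omega>))"
      using exponent[of 1 v] by simp
    also have "\<dots> \<le> (LINT \<omega>|M. cmod (iexp (v * X 1 \<omega>)))"
      by (rule integral_norm_bound)
    also have "\<dots> = 1" by (simp add: prob_space)
    finally show ?thesis by simp
  qed
  show ?thesis
  proof (rule exI[of _ "4 powr (p + 1) * k"], intro conjI allI impI)
    show "0 \<le> 4 powr (p + 1) * k" using k by simp
    fix t T A B :: real
    assume t: "0 < t" "t \<le> 1" and T: "\<delta> \<le> T" and A: "0 \<le> A"
      and "\<forall>v. \<delta> < v \<longrightarrow> v \<le> T \<longrightarrow> Re (\<Psi> v) \<le> A * v powr \<beta> \<and> \<bar>Im (\<Psi> v)\<bar> \<le> B * v powr \<beta>"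
    then have bounds: "Re (\<Psi> v) \<le> A * v powr \<beta>" "\<bar>Im (\<Psi> v)\<bar> \<le> B * v powr \<beta>" if "\<delta> < v" "v \<le> T" for v
      using that by auto
    have T0: "0 < T" using \<delta> T by simp
    define h where "h v = ennreal (10 * t) * char_defect M (X 1) v * indicator {0<..\<delta>} v
      + ennreal (t * A * v powr \<beta> + (t * B)\<^sup>2 * v powr (2 * \<beta>)) * indicator {\<delta><..T} v
      + 2 * indicator {T<..} v" for v
    have h_measurable [measurable]: "h \<in> borel_measurable borel"
      unfolding h_def by measurable
    have "sup_moment M X p t
      \<le> ennreal (4 powr (p + 1)) * (\<integral>\<^sup>+v. h v * ennreal (v powr (- p - 1)) * indicator {0<..} v \<partial>lborel)"
    proof (rule sup_moment_le_char_defect)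
      fix s v :: real assume s: "0 \<le> s" "s \<le> t" and v: "0 < v"
      consider "v \<le> \<delta>" | "\<delta> < v" "v \<le> T" | "T < v" by linarith
      then show "char_defect M (X s) v \<le> h v"
      proof cases
        case 1
        have "char_defect M (X s) v \<le> ennreal (10 * t * (1 - Re (exp (- \<Psi> v))))"
          unfolding defect[OF s(1)] using s t v 1
          by (intro ennreal_leI one_minus_Re_exp_compare Re_nonneg small) auto
        also have "\<dots> = ennreal (10 * t) * char_defect M (X 1) v"
          using t by (simp add: defect ennreal_mult')
        finally show ?thesis using 1 v T by (simp add: h_def)
      next
        case 2
        have "1 - Re (exp (- of_real s * \<Psi> v)) \<le> s * Re (\<Psi> v) + (s * Im (\<Psi> v))\<^sup>2"
          by (rule one_minus_Re_exp_le[OF s(1) Re_nonneg])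
        also have "s * Re (\<Psi> v) \<le> t * (A * v powr \<beta>)"
          using s t bounds[OF 2] Re_nonneg[of v] by (intro mult_mono) auto
        also have "(s * Im (\<Psi> v))\<^sup>2 \<le> (t * (B * v powr \<beta>))\<^sup>2"
          using s t bounds[OF 2] by (intro power2_le_iff_abs_le[THEN iffD2]) (auto simp: abs_mult intro!: mult_mono)
        also have "(t * (B * v powr \<beta>))\<^sup>2 = (t * B)\<^sup>2 * v powr (2 * \<beta>)"
          by (simp add: power_mult_distrib power2_eq_square powr_add[symmetric] mult_ac)
        finally show ?thesis
          unfolding defect[OF s(1)] using 2 v by (auto simp: h_def mult.assoc intro!: ennreal_leI)
      next
        case 3
        then show ?thesis using char_defect_le_2[of "X s" v] v T by (simp add: h_def)
      qed
    qed (use t p in auto)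
    also have "(\<integral>\<^sup>+v. h v * ennreal (v powr (- p - 1)) * indicator {0<..} v \<partial>lborel)
      \<le> (\<integral>\<^sup>+v. ennreal (10 * t) * (char_defect M (X 1) v * ennreal (v powr (- p - 1)) * indicator {0<..} v)
        + (ennreal (t * A * T powr (\<beta> - p)) * (ennreal (v powr - 1) * indicator {\<delta><..T} v)
        + (ennreal ((t * B)\<^sup>2) * (ennreal (v powr (2 * \<beta> - p - 1)) * indicator {0<..T} v)
        + 2 * (ennreal (v powr (- p - 1)) * indicator {T<..} v))) \<partial>lborel)"
    proof (intro nn_integral_mono)
      fix v :: real
      consider "v \<le> 0" | "0 < v" "v \<le> \<delta>" | "\<delta> < v" "v \<le> T" | "T < v" by linarith
      then show "h v * ennreal (v powr (- p - 1)) * indicator {0<..} v \<le>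
        ennreal (10 * t) * (char_defect M (X 1) v * ennreal (v powr (- p - 1)) * indicator {0<..} v)
        + (ennreal (t * A * T powr (\<beta> - p)) * (ennreal (v powr - 1) * indicator {\<delta><..T} v)
        + (ennreal ((t * B)\<^sup>2) * (ennreal (v powr (2 * \<beta> - p - 1)) * indicator {0<..T} v)
        + 2 * (ennreal (v powr (- p - 1)) * indicator {T<..} v)))"
      proof cases
        case 1
        then show ?thesis by simp
      next
        case 2
        then show ?thesis using T by (simp add: h_def mult.assoc)
      next
        case 3
        then have v: "0 < v" using \<delta> by simp
        \<comment> \<open>Replacing \<open>v powr (\<beta> - p)\<close> by its value at \<open>T\<close> leaves \<open>1 / v\<close>, whose integral is a
          logarithm in the case \<open>\<beta> = p\<close> as well as in the case \<open>\<beta> > p\<close>.\<close>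
        have "t * A * v powr \<beta> * v powr (- p - 1) = t * A * (v powr (\<beta> - p) * v powr - 1)"
          using v powr_add[of v \<beta> "- p - 1"] powr_add[of v "\<beta> - p" "- 1"] by (simp add: add_diff_eq mult.assoc)
        also have "\<dots> \<le> t * A * (T powr (\<beta> - p) * v powr - 1)"
          using v t A p 3 by (intro mult_left_mono mult_right_mono powr_mono2) auto
        finally have 1: "t * A * v powr \<beta> * v powr (- p - 1) \<le> t * A * T powr (\<beta> - p) * v powr - 1"
          by (simp add: mult.assoc)
        have 2: "(t * B)\<^sup>2 * v powr (2 * \<beta>) * v powr (- p - 1) = (t * B)\<^sup>2 * v powr (2 * \<beta> - p - 1)"
          using v by (simp add: powr_add[symmetric] mult.assoc) (simp add: algebra_simps)
        have "h v * ennreal (v powr (- p - 1))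
            = ennreal ((t * A * v powr \<beta> + (t * B)\<^sup>2 * v powr (2 * \<beta>)) * v powr (- p - 1))"
          using 3 by (simp add: h_def ennreal_mult'')
        also have "\<dots> \<le> ennreal (t * A * T powr (\<beta> - p) * v powr - 1 + (t * B)\<^sup>2 * v powr (2 * \<beta> - p - 1))"
          using 1 unfolding distrib_right 2 by (intro ennreal_leI add_mono) auto
        also have "\<dots> = ennreal (t * A * T powr (\<beta> - p)) * ennreal (v powr - 1) + ennreal ((t * B)\<^sup>2) * ennreal (v powr (2 * \<beta> - p - 1))"
          using t(1)[THEN less_imp_le] A
          by (simp only: ennreal_plus ennreal_mult mult_nonneg_nonneg powr_ge_zero zero_le_power2)
        finally show ?thesis using 3 v by (simp add: add_increasing)
      next
        case 4
        then show ?thesis using T0 T by (simp add: h_def mult.assoc add_increasing)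
      qed
    qed
    also have "\<dots> = ennreal (10 * t) * I
        + (ennreal (t * A * T powr (\<beta> - p)) * (\<integral>\<^sup>+v. ennreal (v powr - 1) * indicator {\<delta><..T} v \<partial>lborel)
        + (ennreal ((t * B)\<^sup>2) * (\<integral>\<^sup>+v. ennreal (v powr (2 * \<beta> - p - 1)) * indicator {0<..T} v \<partial>lborel)
        + 2 * (\<integral>\<^sup>+v. ennreal (v powr (- p - 1)) * indicator {T<..} v \<partial>lborel)))"
      unfolding I_def by (simp add: nn_integral_add nn_integral_cmult)
    also have "\<dots> \<le> ennreal (10 * t) * ennreal D
        + (ennreal (t * A * T powr (\<beta> - p)) * ennreal (ln (T / \<delta>))
        + (ennreal ((t * B)\<^sup>2) * ennreal (T powr (2 * \<beta> - p) / (2 * \<beta> - p))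
        + ennreal 2 * ennreal (T powr (- p) / p)))"
    proof (intro add_mono mult_left_mono)
      show "(\<integral>\<^sup>+v. ennreal (v powr - 1) * indicator {\<delta><..T} v \<partial>lborel) \<le> ennreal (ln (T / \<delta>))"
        using \<delta> T by (rule nn_integral_inverse_log)
    qed (use D p T0 nn_integral_powr_from_0[of "2 * \<beta> - p - 1" T] nn_integral_powr_to_inf[of "- p - 1" T] in auto)
    also have "\<dots> = ennreal (10 * t * D + (t * A * T powr (\<beta> - p) * ln (T / \<delta>)
        + ((t * B)\<^sup>2 * (T powr (2 * \<beta> - p) / (2 * \<beta> - p)) + 2 * (T powr (- p) / p))))"
    proof -
      have "0 \<le> 10 * t" "0 \<le> t * A * T powr (\<beta> - p)" "0 \<le> ln (T / \<delta>)" "0 \<le> T powr (2 * \<beta> - p) / (2 * \<beta> - p)"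
        "0 \<le> T powr (- p) / p" "(0::real) \<le> 2"
        using t A p T \<delta> by auto
      then show ?thesis
        using D(2) by (simp only: ennreal_mult[symmetric] ennreal_plus[symmetric] mult_nonneg_nonneg add_nonneg_nonneg zero_le_power2)
    qed
    also have "\<dots> \<le> ennreal (k * (t + t * A * T powr (\<beta> - p) * ln (T / \<delta>)
        + (t * B)\<^sup>2 * T powr (2 * \<beta> - p) + T powr (- p)))"
    proof (intro ennreal_leI)
      have "10 * D * t \<le> k * t"
        using k t by (intro mult_right_mono) auto
      moreover have "1 * (t * A * T powr (\<beta> - p) * ln (T / \<delta>)) \<le> k * (t * A * T powr (\<beta> - p) * ln (T / \<delta>))"
        using k t A T \<delta> by (intro mult_right_mono mult_nonneg_nonneg) auto
      moreover have "1 / (2 * \<beta> - p) * ((t * B)\<^sup>2 * T powr (2 * \<beta> - p)) \<le> k * ((t * B)\<^sup>2 * T powr (2 * \<beta> - p))"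
        using k by (intro mult_right_mono) auto
      moreover have "2 / p * T powr (- p) \<le> k * T powr (- p)"
        using k by (intro mult_right_mono) auto
      ultimately show "10 * t * D + (t * A * T powr (\<beta> - p) * ln (T / \<delta>)
          + ((t * B)\<^sup>2 * (T powr (2 * \<beta> - p) / (2 * \<beta> - p)) + 2 * (T powr (- p) / p)))
        \<le> k * (t + t * A * T powr (\<beta> - p) * ln (T / \<delta>)
          + (t * B)\<^sup>2 * T powr (2 * \<beta> - p) + T powr (- p))"
        by (simp add: distrib_left mult_ac)
    qed
    finally show "sup_moment M X p t \<le> ennreal (4 powr (p + 1) * k * (t + t * A * T powr (\<beta> - p) * ln (T / \<delta>)
        + (t * B)\<^sup>2 * T powr (2 * \<beta> - p) + T powr (- p)))"
      by (simp add: ennreal_mult' mult_left_mono mult.assoc)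
  qed
qed

lemma bigo_at_zeroI:
  assumes "\<forall>\<^sub>F t in at_right 0. f t \<le> ennreal (K * g t)"
  shows "bigo_at_zero f g"
  unfolding bigo_at_zero_def
proof
  show "\<forall>\<^sub>F t in at_right 0. f t < \<infinity>"
    using assms by eventually_elim (auto intro: le_less_trans)
  show "(\<lambda>t. enn2real (f t)) \<in> O[at_right 0](g)"
  proof (rule bigoI)
    show "\<forall>\<^sub>F t in at_right 0. norm (enn2real (f t)) \<le> \<bar>K\<bar> * norm (g t)"
      using assms
    proof eventually_elim
      case (elim t)
      have "f t \<le> ennreal \<bar>K * g t\<bar>"
        using elim by (rule order_trans) (simp add: ennreal_leI)
      then show ?case by (simp add: enn2real_leI abs_mult)
    qed
  qed
qed

text \<open>
  At \<open>T = t powr (- 1 / p)\<close> the exponent bound \<open>t * A * v powr p\<close> reaches the order of the trivial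
  bound 2.  The part above \<open>T\<close> and the quadratic term are then \<open>O(t)\<close>, and \<open>ln (T / \<delta>)\<close>
  is of order \<open>- ln t\<close>.
\<close>
lemma (in levy_process) bigo_sup_moment_index:
  fixes \<Psi> :: "real \<Rightarrow> complex" and p \<delta> A :: real
  assumes exponent: "\<And>u s. 0 \<le> s \<Longrightarrow> (CLINT \<omega>|M. iexp (u * X s \<omega>)) = exp (- of_real s * \<Psi> u)"
    and \<delta>: "0 < \<delta>" "\<delta> \<le> 1" and small: "\<And>v. 0 < v \<Longrightarrow> v \<le> \<delta> \<Longrightarrow> cmod (\<Psi> v) \<le> 1"
    and p: "0 < p" "p < 2" and moment: "integrable M (\<lambda>\<omega>. \<bar>X 1 \<omega>\<bar> powr p)" and A: "0 \<le> A"
    and bounds: "\<And>v. \<delta> < v \<Longrightarrow> Re (\<Psi> v) \<le> A * v powr p \<and> \<bar>Im (\<Psi> v)\<bar> \<le> A * v powr p"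
  shows "bigo_at_zero (sup_moment M X p) (\<lambda>t. t * (- ln t))"
proof -
  obtain K where K: "0 \<le> K" and main: "\<forall>t T A B. 0 < t \<longrightarrow> t \<le> 1 \<longrightarrow> \<delta> \<le> T \<longrightarrow> 0 \<le> A \<longrightarrow>
      (\<forall>v. \<delta> < v \<longrightarrow> v \<le> T \<longrightarrow> Re (\<Psi> v) \<le> A * v powr p \<and> \<bar>Im (\<Psi> v)\<bar> \<le> B * v powr p) \<longrightarrow>
      sup_moment M X p t \<le> ennreal (K * (t + t * A * T powr (p - p) * ln (T / \<delta>)
        + (t * B)\<^sup>2 * T powr (2 * p - p) + T powr (- p)))"
    using sup_moment_le_exponent[OF exponent \<delta>(1) small p(1) _ order_refl moment] p by auto
  show ?thesis
  proof (rule bigo_at_zeroI)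
    \<comment> \<open>For \<open>t < exp (- 1)\<close> the factor \<open>- ln t\<close> is at least 1, so constants are absorbed into it.\<close>
    have "\<forall>\<^sub>F t in at_right (0::real). t \<in> {0<..<exp (- 1)}"
      by (rule eventually_at_right_real) simp
    then show "\<forall>\<^sub>F t in at_right 0. sup_moment M X p t \<le> ennreal (K * (2 + A * (1 / p + ln (1 / \<delta>)) + A\<^sup>2) * (t * - ln t))"
    proof eventually_elim
      case (elim t)
      define L where "L = - ln t"
      have t: "0 < t" "t < 1" using elim exp_le_one_iff[of "-1::real"] by (auto intro: less_le_trans)
      have L: "1 \<le> L" using elim ln_less_cancel_iff[of t "exp (- 1)"] by (simp add: L_def)
      define T where "T = t powr (- 1 / p)"
      have lnT: "ln T = L / p"
        using t by (simp add: T_def ln_powr L_def)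
      have T: "1 \<le> T" "T powr p = 1 / t" "T powr (- p) = t"
        using t p ge_one_powr_ge_zero[of "1 / t" "1 / p"]
        by (auto simp: T_def powr_powr powr_minus_divide powr_divide)
      have "sup_moment M X p t \<le> ennreal (K * (t + t * A * T powr (p - p) * ln (T / \<delta>)
        + (t * A)\<^sup>2 * T powr (2 * p - p) + T powr (- p)))"
        using t T \<delta> A bounds by (intro main[rule_format]) auto
      also have "\<dots> \<le> ennreal (K * ((2 + A * (1 / p + ln (1 / \<delta>)) + A\<^sup>2) * (t * L)))"
      proof (intro ennreal_leI mult_left_mono K)
        have ld: "0 \<le> ln (1 / \<delta>)" using \<delta> by simp
        have "ln (T / \<delta>) = L / p + ln (1 / \<delta>)"
          using T \<delta> by (simp add: ln_div lnT)
        also have "\<dots> \<le> L / p + ln (1 / \<delta>) * L"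
          using mult_left_mono[OF L ld] by simp
        also have "\<dots> = (1 / p + ln (1 / \<delta>)) * L" by (simp add: distrib_right)
        finally have "t * A * ln (T / \<delta>) \<le> t * A * ((1 / p + ln (1 / \<delta>)) * L)"
          using t A by (intro mult_left_mono) auto
        moreover have "(t * A)\<^sup>2 * (1 / t) = A\<^sup>2 * t"
          using t by (simp add: power2_eq_square)
        moreover have "A\<^sup>2 * t \<le> A\<^sup>2 * (t * L)" "t \<le> t * L"
          using t L by (auto intro!: mult_left_mono)
        ultimately show "t + t * A * T powr (p - p) * ln (T / \<delta>) + (t * A)\<^sup>2 * T powr (2 * p - p) + T powr (- p)
          \<le> (2 + A * (1 / p + ln (1 / \<delta>)) + A\<^sup>2) * (t * L)"
          using T by (simp add: algebra_simps)
      qed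
      finally show ?case by (simp add: L_def mult.assoc)
    qed
  qed
qed

text \<open>
  In the critical case the imaginary part of the exponent carries a logarithm, which is at most
  \<open>L = - ln t\<close> for the frequencies below \<open>T = 1 / w\<close> with \<open>w = t L\<close>.  Each of the terms
  \<open>t A T powr (1 - p) ln (T / \<delta>)\<close>, \<open>(t A L)\<^sup>2 T powr (2 - p)\<close> and \<open>T powr (- p)\<close> is then of order
  \<open>w powr p\<close>.  The parameter \<open>L\<close> in the hypothesis on the imaginary part is kept free, so that the
  hypothesis does not refer to \<open>t\<close>.
\<close>
lemma (in levy_process) bigo_sup_moment_critical:
  fixes \<Psi> :: "real \<Rightarrow> complex" and p \<delta> A :: real
  assumes exponent: "\<And>u s. 0 \<le> s \<Longrightarrow> (CLINT \<omega>|M. iexp (u * X s \<omega>)) = exp (- of_real s * \<Psi> u)"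
    and \<delta>: "0 < \<delta>" "\<delta> \<le> 1" and small: "\<And>v. 0 < v \<Longrightarrow> v \<le> \<delta> \<Longrightarrow> cmod (\<Psi> v) \<le> 1"
    and p: "0 < p" "p \<le> 1" and moment: "integrable M (\<lambda>\<omega>. \<bar>X 1 \<omega>\<bar> powr p)" and A: "0 \<le> A"
    and Re_bound: "\<And>v. \<delta> < v \<Longrightarrow> Re (\<Psi> v) \<le> A * v"
    and Im_bound: "\<And>v L. \<delta> < v \<Longrightarrow> 1 \<le> L \<Longrightarrow> ln v \<le> L \<Longrightarrow> \<bar>Im (\<Psi> v)\<bar> \<le> A * L * v"
  shows "bigo_at_zero (sup_moment M X p) (\<lambda>t. (t * (- ln t)) powr p)"
proof -
  obtain K where K: "0 \<le> K" and main: "\<forall>t T A B. 0 < t \<longrightarrow> t \<le> 1 \<longrightarrow> \<delta> \<le> T \<longrightarrow> 0 \<le> A \<longrightarrow>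
      (\<forall>v. \<delta> < v \<longrightarrow> v \<le> T \<longrightarrow> Re (\<Psi> v) \<le> A * v powr 1 \<and> \<bar>Im (\<Psi> v)\<bar> \<le> B * v powr 1) \<longrightarrow>
      sup_moment M X p t \<le> ennreal (K * (t + t * A * T powr (1 - p) * ln (T / \<delta>)
        + (t * B)\<^sup>2 * T powr (2 * 1 - p) + T powr (- p)))"
    using sup_moment_le_exponent[OF exponent \<delta>(1) small p(1) _ p(2) moment] p by auto
  show ?thesis
  proof (rule bigo_at_zeroI)
    \<comment> \<open>For \<open>t < exp (- 1)\<close> the factor \<open>- ln t\<close> is at least 1, so constants are absorbed into it.\<close>
    have "\<forall>\<^sub>F t in at_right (0::real). t \<in> {0<..<exp (- 1)}"
      by (rule eventually_at_right_real) simp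
    then show "\<forall>\<^sub>F t in at_right 0. sup_moment M X p t \<le> ennreal (K * (2 + A * (1 + ln (1 / \<delta>)) + A\<^sup>2) * (t * - ln t) powr p)"
    proof eventually_elim
      case (elim t)
      define L where "L = - ln t"
      define w where "w = t * L"
      have t: "0 < t" "t < 1" using elim exp_le_one_iff[of "-1::real"] by (auto intro: less_le_trans)
      have L: "1 \<le> L" using elim ln_less_cancel_iff[of t "exp (- 1)"] by (simp add: L_def)
      have w0: "0 < w" using t L by (simp add: w_def)
      have "L \<le> 1 / t - 1"
        using ln_le_minus_one[of "1 / t"] t by (simp add: L_def ln_div)
      then have w1: "w \<le> 1"
        using mult_left_mono[of L "1 / t - 1" t] t by (simp add: w_def right_diff_distrib)
      define T where "T = 1 / w"
      have T: "1 \<le> T" "T powr r = w powr (- r)" for r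
        using w0 w1 by (auto simp: T_def powr_divide powr_minus_divide)
      have lnT: "ln T \<le> L"
      proof -
        have "ln T = - ln w" using w0 by (simp add: T_def ln_div)
        also have "ln w = ln t + ln L" using t L by (simp add: w_def ln_mult)
        finally show ?thesis using L ln_ge_zero[OF L] by (simp add: L_def)
      qed
      have "sup_moment M X p t \<le> ennreal (K * (t + t * A * T powr (1 - p) * ln (T / \<delta>)
        + (t * (A * L))\<^sup>2 * T powr (2 * 1 - p) + T powr (- p)))"
      proof (rule main[rule_format])
        fix v assume v: "\<delta> < v" "v \<le> T"
        then have "ln v \<le> ln T" using \<delta> by (intro ln_mono) auto
        then show "Re (\<Psi> v) \<le> A * v powr 1 \<and> \<bar>Im (\<Psi> v)\<bar> \<le> A * L * v powr 1"
          using v \<delta> Re_bound[of v] Im_bound[of v L] L order_trans[OF _ lnT, of "ln v"] \<open>ln v \<le> ln T\<close> by auto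
      qed (use t T(1) \<delta> A in auto)
      also have "\<dots> \<le> ennreal (K * ((2 + A * (1 + ln (1 / \<delta>)) + A\<^sup>2) * w powr p))"
      proof (intro ennreal_leI mult_left_mono K)
        have ld: "0 \<le> ln (1 / \<delta>)" using \<delta> by simp
        have "ln (T / \<delta>) = ln T + ln (1 / \<delta>)"
          using T(1) \<delta> by (simp add: ln_div)
        also have "\<dots> \<le> L + ln (1 / \<delta>) * L"
          using lnT mult_left_mono[OF L ld] by simp
        also have "\<dots> = (1 + ln (1 / \<delta>)) * L" by (simp add: distrib_right)
        finally have "t * A * w powr (p - 1) * ln (T / \<delta>) \<le> t * A * w powr (p - 1) * ((1 + ln (1 / \<delta>)) * L)"
          using t A by (intro mult_left_mono) auto
        also have "\<dots> = A * (1 + ln (1 / \<delta>)) * (w powr (p - 1) * w)"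
          by (simp add: w_def mult_ac)
        also have "w powr (p - 1) * w = w powr p"
          using w0 by (simp add: powr_diff)
        finally have 1: "t * A * w powr (p - 1) * ln (T / \<delta>) \<le> A * (1 + ln (1 / \<delta>)) * w powr p" .
        have "(t * (A * L))\<^sup>2 * w powr (p - 2) = A\<^sup>2 * (w powr (p - 2) * w\<^sup>2)"
          by (simp add: w_def power_mult_distrib mult_ac)
        also have "w powr (p - 2) * w\<^sup>2 = w powr p"
          using w0 by (simp add: powr_diff)
        finally have 2: "(t * (A * L))\<^sup>2 * w powr (p - 2) = A\<^sup>2 * w powr p" .
        have "t \<le> w" using t L by (simp add: w_def)
        also have "w = w powr 1" using w0 by simp
        also have "\<dots> \<le> w powr p" using w0 w1 p by (intro powr_mono') auto
        finally show "t + t * A * T powr (1 - p) * ln (T / \<delta>) + (t * (A * L))\<^sup>2 * T powr (2 * 1 - p) + T powr (- p)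
          \<le> (2 + A * (1 + ln (1 / \<delta>)) + A\<^sup>2) * w powr p"
          using 1 2 unfolding T(2) by (simp add: distrib_right)
      qed
      finally show ?case by (simp add: w_def L_def mult.assoc)
    qed
  qed
qed

section \<open>The characteristic exponent\<close>

text \<open>\<open>min (x\<^sup>2) 1\<close> is the integrable function through which the defining property of a Levy
  measure enters.\<close>
lemma cmod_levy_integrand_le:
  fixes u x :: real
  shows "cmod (iexp (u * x) - 1 - \<i> * of_real (u * x * indicator {x. \<bar>x\<bar> \<le> 1} x)) \<le> (2 + u\<^sup>2) * min (x\<^sup>2) 1"
proof (cases "\<bar>x\<bar> \<le> 1")
  case True
  have "cmod (iexp (u * x) - 1 - \<i> * of_real (u * x)) \<le> (u * x)\<^sup>2 / 2"
    using iexp_approx1[of "u * x" 1] by (simp add: diff_diff_eq fact_numeral power_even_abs eval_nat_numeral)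
  also have "\<dots> \<le> (2 + u\<^sup>2) * x\<^sup>2"
    by (simp add: power_mult_distrib algebra_simps add_increasing)
  finally show ?thesis using True by (simp add: min_def abs_square_le_1)
next
  case False
  have "cmod (iexp (u * x) - 1) \<le> 1 + 1"
    using norm_triangle_ineq4[of "iexp (u * x)" 1] by simp
  also have "\<dots> \<le> (2 + u\<^sup>2) * 1" by simp
  finally show ?thesis using False abs_square_less_1[of x] by (simp add: min_def abs_square_le_1)
qed

lemma levy_measure_integrable_min:
  assumes "levy_measure \<nu>"
  shows "integrable \<nu> (\<lambda>x. min (x\<^sup>2) 1)"
proof (rule integrableI_nonneg)
  have [measurable_cong]: "sets \<nu> = sets borel" using assms by (simp add: levy_measure_def)
  show "(\<lambda>x. min (x\<^sup>2) 1) \<in> borel_measurable \<nu>" by measurable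
qed (use assms in \<open>auto simp: levy_measure_def\<close>)

lemma levy_integrand_integrable:
  assumes "levy_measure \<nu>"
  shows "integrable \<nu> (\<lambda>x. iexp (u * x) - 1 - \<i> * of_real (u * x * indicator {x. \<bar>x\<bar> \<le> 1} x))"
proof (rule Bochner_Integration.integrable_bound)
  have [measurable_cong]: "sets \<nu> = sets borel" using assms by (simp add: levy_measure_def)
  show "integrable \<nu> (\<lambda>x. (2 + u\<^sup>2) * min (x\<^sup>2) 1)"
    using levy_measure_integrable_min[OF assms] by simp
  show "(\<lambda>x. iexp (u * x) - 1 - \<i> * of_real (u * x * indicator {x. \<bar>x\<bar> \<le> 1} x)) \<in> borel_measurable \<nu>"
    by measurable
  show "AE x in \<nu>. norm (iexp (u * x) - 1 - \<i> * of_real (u * x * indicator {x. \<bar>x\<bar> \<le> 1} x)) \<le> norm ((2 + u\<^sup>2) * min (x\<^sup>2) 1)"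
    using cmod_levy_integrand_le[of u] by (intro AE_I2) (auto intro: order_trans[OF _ abs_ge_self])
qed

lemma Re_levy_exponent:
  assumes "levy_measure \<nu>"
  shows "Re (levy_exponent a 0 \<nu> u) = (LINT x|\<nu>. 1 - cos (u * x))"
proof -
  have "(LINT x|\<nu>. 1 - cos (u * x)) = - (LINT x|\<nu>. cos (u * x) - 1)"
    by (subst Bochner_Integration.integral_minus[symmetric]) simp
  then show ?thesis
    unfolding levy_exponent_def using integral_Re[OF levy_integrand_integrable[OF assms, of u]]
    by (simp add: Re_exp)
qed

lemma Im_levy_exponent:
  assumes "levy_measure \<nu>"
  shows "Im (levy_exponent a 0 \<nu> u) = - u * a - (LINT x|\<nu>. sin (u * x) - u * x * indicator {x. \<bar>x\<bar> \<le> 1} x)"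
  unfolding levy_exponent_def using integral_Im[OF levy_integrand_integrable[OF assms, of u]]
  by (simp add: Im_exp)

text \<open>
  Dominated convergence along sequences of frequencies: a convergent sequence is bounded, and the
  bound \<open>(2 + u\<^sup>2) * min (x\<^sup>2) 1\<close> is uniform for bounded \<open>u\<close>.
\<close>
lemma levy_exponent_tendsto_0:
  assumes "levy_measure \<nu>"
  shows "(levy_exponent a 0 \<nu> \<longlongrightarrow> 0) (at 0)"
proof -
  have [measurable_cong]: "sets \<nu> = sets borel" using assms by (simp add: levy_measure_def)
  let ?F = "\<lambda>u x. iexp (u * x) - 1 - \<i> * of_real (u * x * indicator {x. \<bar>x\<bar> \<le> 1} x)"
  have "(\<lambda>u. CLINT x|\<nu>. ?F u x) \<midarrow>0\<rightarrow> 0"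
  proof (subst LIMSEQ_SEQ_conv[symmetric], intro allI impI)
    fix S :: "nat \<Rightarrow> real" assume S: "(\<forall>n. S n \<noteq> 0) \<and> S \<longlonglongrightarrow> 0"
    then obtain B where B: "\<And>n. \<bar>S n\<bar> \<le> B"
      using convergent_imp_Bseq[of S] by (auto simp: convergent_def Bseq_def)
    have "(\<lambda>n. CLINT x|\<nu>. ?F (S n) x) \<longlonglongrightarrow> (CLINT x|\<nu>. 0)"
    proof (rule integral_dominated_convergence[where w="\<lambda>x. (2 + B\<^sup>2) * min (x\<^sup>2) 1"])
      show "integrable \<nu> (\<lambda>x. (2 + B\<^sup>2) * min (x\<^sup>2) 1)"
        using levy_measure_integrable_min[OF assms] by simp
      show "AE x in \<nu>. (\<lambda>n. ?F (S n) x) \<longlonglongrightarrow> 0"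
      proof (intro AE_I2)
        fix x
        have "(\<lambda>n. ?F (S n) x) \<longlonglongrightarrow> ?F 0 x"
          using S by (intro tendsto_intros) auto
        then show "(\<lambda>n. ?F (S n) x) \<longlonglongrightarrow> 0" by simp
      qed
      show "AE x in \<nu>. norm (?F (S n) x) \<le> (2 + B\<^sup>2) * min (x\<^sup>2) 1" for n
      proof (intro AE_I2)
        fix x :: real
        have "(S n)\<^sup>2 \<le> B\<^sup>2" using B[of n] by (simp add: abs_le_square_iff[symmetric])
        then have "(2 + (S n)\<^sup>2) * min (x\<^sup>2) 1 \<le> (2 + B\<^sup>2) * min (x\<^sup>2) 1"
          by (intro mult_right_mono) auto
        then show "norm (?F (S n) x) \<le> (2 + B\<^sup>2) * min (x\<^sup>2) 1"
          using cmod_levy_integrand_le[of "S n" x] by linarith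
      qed
    qed measurable
    then show "(\<lambda>n. CLINT x|\<nu>. ?F (S n) x) \<longlonglongrightarrow> 0" by simp
  qed
  then have "(levy_exponent a 0 \<nu> \<longlongrightarrow> - \<i> * of_real 0 * of_real a + of_real (0 * 0\<^sup>2 / 2) - 0) (at 0)"
    unfolding levy_exponent_def by (intro tendsto_intros) simp_all
  then show ?thesis by simp
qed

lemma levy_exponent_small:
  assumes "levy_measure \<nu>"
  obtains \<delta> where "0 < \<delta>" "\<delta> \<le> 1" "\<And>v. 0 < v \<Longrightarrow> v \<le> \<delta> \<Longrightarrow> cmod (levy_exponent a 0 \<nu> v) \<le> 1"
proof -
  obtain d where d: "0 < d" "\<And>v. v \<noteq> 0 \<Longrightarrow> \<bar>v\<bar> < d \<Longrightarrow> cmod (levy_exponent a 0 \<nu> v) < 1"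
    using levy_exponent_tendsto_0[OF assms, of a, THEN tendstoD, of 1]
    by (auto simp: eventually_at dist_norm)
  show thesis
    by (rule that[of "min 1 (d / 2)"]) (use d in \<open>auto intro!: less_imp_le\<close>)
qed

section \<open>Integrals of jumps dominated by a stable law\<close>

text \<open>Up to constants, the density on the right is that of the Levy measure of a \<open>\<beta>\<close>-stable process.\<close>
definition small_jumps_dominated :: "real measure \<Rightarrow> real \<Rightarrow> real \<Rightarrow> real \<Rightarrow> bool" where
  "small_jumps_dominated \<nu> \<beta> c C \<longleftrightarrow> (\<forall>A\<in>sets borel.
      emeasure (density \<nu> (indicator {x. 0 < \<bar>x\<bar> \<and> \<bar>x\<bar> \<le> c})) A
        \<le> emeasure (density lborel
             (\<lambda>x. ennreal (C / \<bar>x\<bar> powr (\<beta> + 1)) * indicator {x. 0 < \<bar>x\<bar> \<and> \<bar>x\<bar> \<le> c} x)) A)"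

lemma nn_integral_small_jumps_le:
  fixes g :: "real \<Rightarrow> ennreal" and \<nu> :: "real measure" and \<beta> c C :: real
  assumes sets_\<nu>: "sets \<nu> = sets borel"
    and dom: "small_jumps_dominated \<nu> \<beta> c C"
    and g [measurable]: "g \<in> borel_measurable borel" and C: "0 \<le> C"
  shows "(\<integral>\<^sup>+x. g \<bar>x\<bar> * indicator {x. 0 < \<bar>x\<bar> \<and> \<bar>x\<bar> \<le> c} x \<partial>\<nu>)
    \<le> ennreal (2 * C) * (\<integral>\<^sup>+x. g x * ennreal (x powr (- \<beta> - 1)) * indicator {0<..c} x \<partial>lborel)"
proof -
  note [measurable_cong] = sets_\<nu>
  let ?D = "\<lambda>x. ennreal (C / \<bar>x\<bar> powr (\<beta> + 1)) * indicator {x. 0 < \<bar>x\<bar> \<and> \<bar>x\<bar> \<le> c} x"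
  have "(\<integral>\<^sup>+x. g \<bar>x\<bar> * indicator {x. 0 < \<bar>x\<bar> \<and> \<bar>x\<bar> \<le> c} x \<partial>\<nu>)
      = (\<integral>\<^sup>+x. g \<bar>x\<bar> \<partial>density \<nu> (indicator {x. 0 < \<bar>x\<bar> \<and> \<bar>x\<bar> \<le> c}))"
    by (subst nn_integral_density) (auto simp: mult.commute)
  also have "\<dots> \<le> (\<integral>\<^sup>+x. g \<bar>x\<bar> \<partial>density lborel ?D)"
    by (rule nn_integral_mono_measure) (use dom in \<open>auto simp: le_measure sets_\<nu> small_jumps_dominated_def\<close>)
  also have "\<dots> = (\<integral>\<^sup>+x. ?D x * g \<bar>x\<bar> \<partial>lborel)"
    by (rule nn_integral_density) measurable
  also have "\<dots> = (\<integral>\<^sup>+x. ennreal C * (g \<bar>x\<bar> * ennreal (\<bar>x\<bar> powr (- \<beta> - 1)) * indicator {..c} \<bar>x\<bar> * indicator (- {0}) x) \<partial>lborel)"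
  proof (intro nn_integral_cong)
    fix x :: real
    have "C / \<bar>x\<bar> powr (\<beta> + 1) = C * \<bar>x\<bar> powr (- \<beta> - 1)"
      using powr_minus_divide[of "\<bar>x\<bar>" "\<beta> + 1"] by simp
    then show "?D x * g \<bar>x\<bar> = ennreal C * (g \<bar>x\<bar> * ennreal (\<bar>x\<bar> powr (- \<beta> - 1)) * indicator {..c} \<bar>x\<bar> * indicator (- {0}) x)"
      using C by (auto simp: indicator_def ennreal_mult mult_ac)
  qed
  also have "\<dots> = ennreal C * (\<integral>\<^sup>+x. g \<bar>x\<bar> * ennreal (\<bar>x\<bar> powr (- \<beta> - 1)) * indicator {..c} \<bar>x\<bar> * indicator (- {0}) x \<partial>lborel)"
    by (rule nn_integral_cmult) measurable
  also have "(\<integral>\<^sup>+x. g \<bar>x\<bar> * ennreal (\<bar>x\<bar> powr (- \<beta> - 1)) * indicator {..c} \<bar>x\<bar> * indicator (- {0}) x \<partial>lborel)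
      = 2 * (\<integral>\<^sup>+x. g x * ennreal (x powr (- \<beta> - 1)) * indicator {..c} x * indicator {0<..} x \<partial>lborel)"
    by (rule nn_integral_lborel_abs) measurable
  also have "(\<integral>\<^sup>+x. g x * ennreal (x powr (- \<beta> - 1)) * indicator {..c} x * indicator {0<..} x \<partial>lborel)
      = (\<integral>\<^sup>+x. g x * ennreal (x powr (- \<beta> - 1)) * indicator {0<..c} x \<partial>lborel)"
    by (intro nn_integral_cong) (auto simp: indicator_def)
  finally show ?thesis
    using C by (simp add: ennreal_mult' mult_ac)
qed

lemma levy_measure_large_jumps_finite:
  assumes "levy_measure \<nu>" "0 < c"
  shows "emeasure \<nu> {x. c < \<bar>x\<bar>} < \<infinity>"
proof -
  have [measurable_cong]: "sets \<nu> = sets borel" and fin: "(\<integral>\<^sup>+x. ennreal (min (x\<^sup>2) 1) \<partial>\<nu>) < \<infinity>"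
    using assms by (auto simp: levy_measure_def)
  define m where "m = min (c\<^sup>2) 1"
  have m: "0 < m" using assms by (simp add: m_def)
  have "ennreal m * emeasure \<nu> {x. c < \<bar>x\<bar>} = (\<integral>\<^sup>+x. ennreal m * indicator {x. c < \<bar>x\<bar>} x \<partial>\<nu>)"
    by (rule nn_integral_cmult_indicator[symmetric]) measurable
  also have "\<dots> \<le> (\<integral>\<^sup>+x. ennreal (min (x\<^sup>2) 1) \<partial>\<nu>)"
  proof (intro nn_integral_mono)
    fix x :: real
    have "c\<^sup>2 \<le> x\<^sup>2" if "c < \<bar>x\<bar>"
      using that assms by (simp add: abs_le_square_iff[symmetric])
    then show "ennreal m * indicator {x. c < \<bar>x\<bar>} x \<le> ennreal (min (x\<^sup>2) 1)"
      by (auto simp: indicator_def m_def intro!: ennreal_leI)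
  qed
  finally show ?thesis
    using fin m by (auto simp: less_top[symmetric] ennreal_mult_eq_top_iff top_unique)
qed

text \<open>
  The density bound handles jumps of size at most \<open>c\<close>.  There are only finitely many larger jumps per
  unit of time, so boundedness of \<open>f\<close> suffices for them.
\<close>
lemma nn_integral_jumps_le:
  fixes f g :: "real \<Rightarrow> real" and \<nu> :: "real measure" and \<beta> c C J k :: real
  assumes \<nu>: "levy_measure \<nu>" and c: "0 < c" and C: "0 \<le> C"
    and dom: "small_jumps_dominated \<nu> \<beta> c C"
    and g [measurable]: "g \<in> borel_measurable borel"
    and small: "\<And>x. 0 < \<bar>x\<bar> \<Longrightarrow> \<bar>x\<bar> \<le> c \<Longrightarrow> \<bar>f x\<bar> \<le> g \<bar>x\<bar>"
    and large: "\<And>x. c < \<bar>x\<bar> \<Longrightarrow> \<bar>f x\<bar> \<le> k" and k: "0 \<le> k" and J: "0 \<le> J"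
    and int: "(\<integral>\<^sup>+x. ennreal (g x * x powr (- \<beta> - 1)) * indicator {0<..c} x \<partial>lborel) \<le> ennreal J"
  shows "(\<integral>\<^sup>+x. ennreal \<bar>f x\<bar> \<partial>\<nu>) \<le> ennreal (2 * C * J + k * measure \<nu> {x. c < \<bar>x\<bar>})"
proof -
  have sets_\<nu> [measurable_cong]: "sets \<nu> = sets borel" and "emeasure \<nu> {0} = 0"
    using \<nu> by (auto simp: levy_measure_def)
  then have nz: "AE x in \<nu>. x \<noteq> 0"
    by (intro AE_I[where N="{0}"]) auto
  have "(\<integral>\<^sup>+x. ennreal \<bar>f x\<bar> \<partial>\<nu>)
    \<le> (\<integral>\<^sup>+x. ennreal (g \<bar>x\<bar>) * indicator {x. 0 < \<bar>x\<bar> \<and> \<bar>x\<bar> \<le> c} x + ennreal k * indicator {x. c < \<bar>x\<bar>} x \<partial>\<nu>)"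
    using nz by (intro nn_integral_mono_AE, eventually_elim)
       (auto simp: indicator_def intro!: ennreal_leI small large)
  also have "\<dots> = (\<integral>\<^sup>+x. ennreal (g \<bar>x\<bar>) * indicator {x. 0 < \<bar>x\<bar> \<and> \<bar>x\<bar> \<le> c} x \<partial>\<nu>)
      + (\<integral>\<^sup>+x. ennreal k * indicator {x. c < \<bar>x\<bar>} x \<partial>\<nu>)"
    by (rule nn_integral_add) measurable
  also have "(\<integral>\<^sup>+x. ennreal k * indicator {x. c < \<bar>x\<bar>} x \<partial>\<nu>) = ennreal k * emeasure \<nu> {x. c < \<bar>x\<bar>}"
    by (rule nn_integral_cmult_indicator) measurable
  also have "\<dots> = ennreal (k * measure \<nu> {x. c < \<bar>x\<bar>})"
    using levy_measure_large_jumps_finite[OF \<nu> c] k by (simp add: emeasure_eq_ennreal_measure ennreal_mult)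
  also have "(\<integral>\<^sup>+x. ennreal (g \<bar>x\<bar>) * indicator {x. 0 < \<bar>x\<bar> \<and> \<bar>x\<bar> \<le> c} x \<partial>\<nu>)
      \<le> ennreal (2 * C) * (\<integral>\<^sup>+x. ennreal (g x) * ennreal (x powr (- \<beta> - 1)) * indicator {0<..c} x \<partial>lborel)"
    using C by (intro nn_integral_small_jumps_le[OF sets_\<nu> dom]) auto
  also have "\<dots> \<le> ennreal (2 * C) * ennreal J"
    using int by (intro mult_left_mono) (simp_all add: ennreal_mult'')
  also have "\<dots> + ennreal (k * measure \<nu> {x. c < \<bar>x\<bar>}) = ennreal (2 * C * J + k * measure \<nu> {x. c < \<bar>x\<bar>})"
    using C J k by (simp add: ennreal_mult)
  finally show ?thesis by (simp add: add_right_mono)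
qed

lemma abs_integral_le_of_nn_integral_le:
  fixes f :: "'a \<Rightarrow> real"
  assumes "(\<integral>\<^sup>+x. ennreal \<bar>f x\<bar> \<partial>N) \<le> ennreal K" "0 \<le> K"
  shows "\<bar>integral\<^sup>L N f\<bar> \<le> K"
proof (cases "integrable N f")
  case True
  then have "ennreal \<bar>integral\<^sup>L N f\<bar> \<le> (\<integral>\<^sup>+x. ennreal \<bar>f x\<bar> \<partial>N)"
    using integral_norm_bound_ennreal[of N f] by simp
  then have "ennreal \<bar>integral\<^sup>L N f\<bar> \<le> ennreal K" using assms(1) by (rule order_trans)
  then show ?thesis using assms by simp
next
  \<comment> \<open>\<open>f\<close> may fail to be measurable; its integral is then 0 by convention.\<close>
  case False
  then show ?thesis using assms by (simp add: not_integrable_integral_eq)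
qed

text \<open>The instance of the jump bound in which the integrand at frequency \<open>v\<close> has the
  scaling form \<open>F (v x)\<close> with \<open>F\<close> of order \<open>\<kappa>\<close> at 0 and of order \<open>\<gamma>\<close> at infinity.\<close>
lemma nn_integral_scaled_jumps_le:
  fixes f :: "real \<Rightarrow> real" and \<nu> :: "real measure" and \<beta> c C k v \<gamma> \<kappa> :: real
  assumes \<nu>: "levy_measure \<nu>" and c: "0 < c" and C: "0 \<le> C"
    and dom: "small_jumps_dominated \<nu> \<beta> c C"
    and v: "0 < v" and \<gamma>: "\<gamma> < \<beta>" and \<kappa>: "\<beta> < \<kappa>"
    and small: "\<And>x. \<bar>x\<bar> \<le> c \<Longrightarrow> \<bar>f x\<bar> \<le> 2 * min (\<bar>v * x\<bar> powr \<kappa>) (\<bar>v * x\<bar> powr \<gamma>)"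
    and large: "\<And>x. c < \<bar>x\<bar> \<Longrightarrow> \<bar>f x\<bar> \<le> k" and k: "0 \<le> k"
  shows "(\<integral>\<^sup>+x. ennreal \<bar>f x\<bar> \<partial>\<nu>)
    \<le> ennreal (4 * C * (1 / (\<kappa> - \<beta>) + 1 / (\<beta> - \<gamma>)) * v powr \<beta> + k * measure \<nu> {x. c < \<bar>x\<bar>})"
proof -
  define J where "J = 2 * (v powr \<beta> * (1 / (\<kappa> - \<beta>) + 1 / (\<beta> - \<gamma>)))"
  have "(\<integral>\<^sup>+x. ennreal \<bar>f x\<bar> \<partial>\<nu>) \<le> ennreal (2 * C * J + k * measure \<nu> {x. c < \<bar>x\<bar>})"
  proof (rule nn_integral_jumps_le[OF \<nu> c C dom, where g="\<lambda>x. 2 * min ((v * x) powr \<kappa>) ((v * x) powr \<gamma>)"])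
    show "0 \<le> J" using \<gamma> \<kappa> by (simp add: J_def)
    show "\<bar>f x\<bar> \<le> 2 * min ((v * \<bar>x\<bar>) powr \<kappa>) ((v * \<bar>x\<bar>) powr \<gamma>)" if "\<bar>x\<bar> \<le> c" for x
      using small[OF that] v by (simp add: abs_mult)
    have "(\<integral>\<^sup>+x. ennreal (2 * min ((v * x) powr \<kappa>) ((v * x) powr \<gamma>) * x powr (- \<beta> - 1)) * indicator {0<..c} x \<partial>lborel)
      \<le> (\<integral>\<^sup>+x. 2 * (ennreal (min ((v * x) powr \<kappa>) ((v * x) powr \<gamma>) * x powr (- \<beta> - 1)) * indicator {0<..} x) \<partial>lborel)"
      by (intro nn_integral_mono)
         (auto simp: indicator_def mult.assoc ennreal_mult' simp flip: ennreal_numeral)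
    also have "\<dots> = 2 * (\<integral>\<^sup>+x. ennreal (min ((v * x) powr \<kappa>) ((v * x) powr \<gamma>) * x powr (- \<beta> - 1)) * indicator {0<..} x \<partial>lborel)"
      by (rule nn_integral_cmult) measurable
    also have "\<dots> \<le> 2 * ennreal (v powr \<beta> * (1 / (\<kappa> - \<beta>) + 1 / (\<beta> - \<gamma>)))"
      using v \<gamma> \<kappa> by (intro mult_left_mono nn_integral_truncated_power) auto
    also have "\<dots> = ennreal J"
      unfolding J_def by (subst ennreal_numeral[symmetric], subst ennreal_mult'[symmetric]) auto
    finally show "(\<integral>\<^sup>+x. ennreal (2 * min ((v * x) powr \<kappa>) ((v * x) powr \<gamma>) * x powr (- \<beta> - 1)) * indicator {0<..c} x \<partial>lborel) \<le> ennreal J" .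
  qed (use large k in auto)
  also have "2 * C * J = 4 * C * (1 / (\<kappa> - \<beta>) + 1 / (\<beta> - \<gamma>)) * v powr \<beta>"
    by (simp add: J_def mult_ac)
  finally show ?thesis .
qed

lemma abs_sin_minus_id_le: "\<bar>sin y - y\<bar> \<le> 2 * min (\<bar>y\<bar> powr 2) (\<bar>y\<bar> powr 1)" for y :: real
proof -
  have "Im (iexp y - (\<Sum>k\<le>1. (\<i> * y) ^ k / fact k)) = sin y - y"
    by (simp add: Im_exp)
  then have "\<bar>sin y - y\<bar> \<le> \<bar>y\<bar> ^ Suc 1 / fact (Suc 1)"
    using iexp_approx1[of y 1] abs_Im_le_cmod[of "iexp y - (\<Sum>k\<le>1. (\<i> * y) ^ k / fact k)"] by linarith
  then have "\<bar>sin y - y\<bar> \<le> y\<^sup>2 / 2" by (simp add: power2_eq_square)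
  then have "\<bar>sin y - y\<bar> \<le> 2 * y\<^sup>2" using zero_le_power2[of y] by linarith
  moreover have "\<bar>sin y - y\<bar> \<le> 2 * \<bar>y\<bar>"
    using abs_sin_x_le_abs_x[of y] abs_triangle_ineq4[of "sin y" y] by linarith
  ultimately show ?thesis
    by (cases "y\<^sup>2 \<le> \<bar>y\<bar>") (simp_all add: min_def)
qed

lemma abs_sin_minus_id_le_powr:
  fixes y q :: real
  assumes "1 \<le> q" "q \<le> 2"
  shows "\<bar>sin y - y\<bar> \<le> 2 * \<bar>y\<bar> powr q"
proof (cases "\<bar>y\<bar> \<le> 1")
  case True
  then have "\<bar>y\<bar> powr 2 \<le> \<bar>y\<bar> powr q"
    using assms by (cases "y = 0") (simp, intro powr_mono', auto)
  then show ?thesis using abs_sin_minus_id_le[of y] by linarith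
next
  case False
  then have "\<bar>y\<bar> powr 1 \<le> \<bar>y\<bar> powr q"
    using assms by (intro powr_mono) auto
  then show ?thesis using abs_sin_minus_id_le[of y] by linarith
qed

lemma abs_sin_le_min_powr: "\<bar>sin y\<bar> \<le> 2 * min (\<bar>y\<bar> powr 1) (\<bar>y\<bar> powr 0)" for y :: real
proof (cases "y = 0")
  case False
  have "\<bar>sin y\<bar> \<le> min \<bar>y\<bar> 1" by (simp add: abs_sin_x_le_abs_x)
  also have "\<dots> \<le> 2 * min \<bar>y\<bar> 1" by simp
  finally show ?thesis using False by simp
qed simp

lemma abs_compensated_sin_le:
  fixes x v :: real
  assumes "0 < v"
  shows "\<bar>sin (v * x) - v * x * indicator {x. \<bar>x\<bar> \<le> 1} x\<bar> \<le> 1 + v"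
proof -
  have "\<bar>v * x * indicator {x. \<bar>x\<bar> \<le> 1} x\<bar> \<le> v"
    using assms by (auto simp: indicator_def abs_mult mult_left_le)
  then show ?thesis using abs_sin_le_one[of "v * x"] abs_triangle_ineq4[of "sin (v * x)" "v * x * indicator {x. \<bar>x\<bar> \<le> 1} x"] by linarith
qed

text \<open>Frequencies are bounded below by \<open>\<delta>\<close>, so lower powers are absorbed into higher ones.\<close>
lemma powr_absorb:
  fixes v \<delta> r \<beta> :: real
  assumes "0 < \<delta>" "\<delta> < v" "r \<le> \<beta>"
  shows "v powr r \<le> \<delta> powr (r - \<beta>) * v powr \<beta>"
proof -
  have "v powr r = v powr (r - \<beta>) * v powr \<beta>"
    using assms by (simp add: powr_add[symmetric])
  also have "\<dots> \<le> \<delta> powr (r - \<beta>) * v powr \<beta>"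
    using assms by (intro mult_right_mono powr_mono2') auto
  finally show ?thesis .
qed

section \<open>Growth of the characteristic exponent\<close>

context
  fixes \<nu> :: "real measure" and \<beta> c C :: real
  assumes \<nu>: "levy_measure \<nu>" and c: "0 < c" "c \<le> 1" and C: "0 < C"
    and dom: "small_jumps_dominated \<nu> \<beta> c C"
begin

lemma Re_levy_exponent_le:
  assumes \<beta>: "0 < \<beta>" "\<beta> < 2" and \<delta>: "0 < \<delta>"
  shows "\<exists>A\<ge>0. \<forall>v>\<delta>. Re (levy_exponent a 0 \<nu> v) \<le> A * v powr \<beta>"
proof -
  define A1 where "A1 = 4 * C * (1 / (2 - \<beta>) + 1 / (\<beta> - 0))"
  define N where "N = measure \<nu> {x. c < \<bar>x\<bar>}"
  have A1: "0 \<le> A1" and N: "0 \<le> N" using \<beta> C by (auto simp: A1_def N_def)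
  have "Re (levy_exponent a 0 \<nu> v) \<le> (A1 + 2 * N * \<delta> powr (- \<beta>)) * v powr \<beta>" if v: "\<delta> < v" for v
  proof -
    have "Re (levy_exponent a 0 \<nu> v) \<le> \<bar>LINT x|\<nu>. 1 - cos (v * x)\<bar>"
      unfolding Re_levy_exponent[OF \<nu>] by simp
    also have "\<dots> \<le> A1 * v powr \<beta> + 2 * N"
    proof (rule abs_integral_le_of_nn_integral_le)
      show "0 \<le> A1 * v powr \<beta> + 2 * N" using A1 N by simp
      show "(\<integral>\<^sup>+x. ennreal \<bar>1 - cos (v * x)\<bar> \<partial>\<nu>) \<le> ennreal (A1 * v powr \<beta> + 2 * N)"
        unfolding A1_def N_def
      proof (rule nn_integral_scaled_jumps_le[OF \<nu> c(1) less_imp_le[OF C] dom])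
        show "\<bar>1 - cos (v * x)\<bar> \<le> 2 * min (\<bar>v * x\<bar> powr 2) (\<bar>v * x\<bar> powr 0)" for x
          using one_minus_cos_le[of "v * x"] by simp
        show "\<bar>1 - cos (v * x)\<bar> \<le> 2" for x
          using cos_ge_minus_one[of "v * x"] by simp
      qed (use \<beta> \<delta> v in auto)
    qed
    also have "1 \<le> \<delta> powr (- \<beta>) * v powr \<beta>"
      using powr_absorb[of \<delta> v 0 \<beta>] \<delta> v \<beta> by simp
    then have "2 * N \<le> 2 * N * (\<delta> powr (- \<beta>) * v powr \<beta>)"
      using N mult_left_mono[of 1 _ "2 * N"] by simp
    finally show ?thesis by (simp add: distrib_right mult.assoc)
  qed
  then show ?thesis using A1 N by (intro exI[of _ "A1 + 2 * N * \<delta> powr (- \<beta>)"]) auto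
qed

text \<open>
  The compensated integrand \<open>sin y - y\<close> at \<open>y = v x\<close> is \<open>O(y\<^sup>2)\<close> near 0 and \<open>O(\<bar>y\<bar>)\<close> at infinity.  For
  \<open>1 < \<beta> < 2\<close> these orders lie on either side of \<open>\<beta>\<close>, so the scaling bound applies; the drift
  and the large jumps contribute terms linear in \<open>v\<close>, of lower order.
\<close>
lemma Im_levy_exponent_le_above_1:
  assumes \<beta>: "1 < \<beta>" "\<beta> < 2" and \<delta>: "0 < \<delta>"
  shows "\<exists>A\<ge>0. \<forall>v>\<delta>. \<bar>Im (levy_exponent a 0 \<nu> v)\<bar> \<le> A * v powr \<beta>"
proof -
  define A1 where "A1 = 4 * C * (1 / (2 - \<beta>) + 1 / (\<beta> - 1))"
  define N where "N = measure \<nu> {x. c < \<bar>x\<bar>}"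
  have A1: "0 \<le> A1" and N: "0 \<le> N" using \<beta> C by (auto simp: A1_def N_def)
  have "\<bar>Im (levy_exponent a 0 \<nu> v)\<bar> \<le> (A1 + N * \<delta> powr (- \<beta>) + (\<bar>a\<bar> + N) * \<delta> powr (1 - \<beta>)) * v powr \<beta>" if v: "\<delta> < v" for v
  proof -
    have v0: "0 < v" using \<delta> v by simp
    have "\<bar>LINT x|\<nu>. sin (v * x) - v * x * indicator {x. \<bar>x\<bar> \<le> 1} x\<bar> \<le> A1 * v powr \<beta> + (1 + v) * N"
    proof (rule abs_integral_le_of_nn_integral_le)
      show "0 \<le> A1 * v powr \<beta> + (1 + v) * N" using A1 N v0 by simp
      show "(\<integral>\<^sup>+x. ennreal \<bar>sin (v * x) - v * x * indicator {x. \<bar>x\<bar> \<le> 1} x\<bar> \<partial>\<nu>) \<le> ennreal (A1 * v powr \<beta> + (1 + v) * N)"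
        unfolding A1_def N_def
      proof (rule nn_integral_scaled_jumps_le[OF \<nu> c(1) less_imp_le[OF C] dom])
        show "\<bar>sin (v * x) - v * x * indicator {x. \<bar>x\<bar> \<le> 1} x\<bar> \<le> 2 * min (\<bar>v * x\<bar> powr 2) (\<bar>v * x\<bar> powr 1)" if "\<bar>x\<bar> \<le> c" for x
          using abs_sin_minus_id_le[of "v * x"] that c by simp
      qed (use \<beta> v0 abs_compensated_sin_le in auto)
    qed
    moreover have "\<bar>Im (levy_exponent a 0 \<nu> v)\<bar> \<le> \<bar>a\<bar> * v + \<bar>LINT x|\<nu>. sin (v * x) - v * x * indicator {x. \<bar>x\<bar> \<le> 1} x\<bar>"
      unfolding Im_levy_exponent[OF \<nu>] using abs_triangle_ineq4[of "- v * a"] v0 by (simp add: abs_mult mult.commute)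
    moreover have "N * 1 \<le> N * (\<delta> powr (- \<beta>) * v powr \<beta>)"
      using powr_absorb[of \<delta> v 0 \<beta>] \<delta> v \<beta> N by (intro mult_left_mono) auto
    moreover have "(\<bar>a\<bar> + N) * v \<le> (\<bar>a\<bar> + N) * (\<delta> powr (1 - \<beta>) * v powr \<beta>)"
      using powr_absorb[of \<delta> v 1 \<beta>] \<delta> v \<beta> N by (intro mult_left_mono) auto
    ultimately show ?thesis by (simp add: algebra_simps)
  qed
  then show ?thesis using A1 N by (intro exI[of _ "A1 + N * \<delta> powr (- \<beta>) + (\<bar>a\<bar> + N) * \<delta> powr (1 - \<beta>)"]) auto
qed

text \<open>
  For \<open>\<beta> = 1\<close> the order of \<open>sin y - y\<close> at infinity equals \<open>\<beta>\<close>, and a logarithm appears.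
  The exponent \<open>q = 1 + 1 / L\<close> is slightly above 1, so that \<open>\<bar>v x\<bar> powr q\<close> is integrable
  against \<open>\<bar>x\<bar> powr - 2\<close> near 0 at the cost of a factor \<open>L\<close>, while
  \<open>v powr q \<le> exp 1 * v\<close> because \<open>ln v \<le> L\<close>.
\<close>
lemma Im_levy_exponent_le_at_1:
  assumes \<beta>: "\<beta> = 1" and \<delta>: "0 < \<delta>" "\<delta> \<le> 1"
  shows "\<exists>A\<ge>0. \<forall>v>\<delta>. \<forall>L\<ge>1. ln v \<le> L \<longrightarrow> \<bar>Im (levy_exponent a 0 \<nu> v)\<bar> \<le> A * L * v"
proof -
  define N where "N = measure \<nu> {x. c < \<bar>x\<bar>}"
  have N: "0 \<le> N" by (simp add: N_def)
  have "\<bar>Im (levy_exponent a 0 \<nu> v)\<bar> \<le> (12 * C + N / \<delta> + (\<bar>a\<bar> + N)) * L * v"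
    if v: "\<delta> < v" and L: "1 \<le> L" and lnv: "ln v \<le> L" for v L
  proof -
    have v0: "0 < v" using \<delta> v by simp
    define q where "q = 1 + 1 / L"
    have q: "1 < q" "q \<le> 2" using L by (auto simp: q_def field_simps)
    define J where "J = 6 * v * L"
    have "\<bar>LINT x|\<nu>. sin (v * x) - v * x * indicator {x. \<bar>x\<bar> \<le> 1} x\<bar> \<le> 2 * C * J + (1 + v) * N"
    proof (rule abs_integral_le_of_nn_integral_le)
      show "0 \<le> 2 * C * J + (1 + v) * N" using C N v0 L by (simp add: J_def)
      show "(\<integral>\<^sup>+x. ennreal \<bar>sin (v * x) - v * x * indicator {x. \<bar>x\<bar> \<le> 1} x\<bar> \<partial>\<nu>) \<le> ennreal (2 * C * J + (1 + v) * N)"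
        unfolding N_def
      proof (rule nn_integral_jumps_le[OF \<nu> c(1) less_imp_le[OF C] dom, where g="\<lambda>x. 2 * (v * x) powr q"])
        show "\<bar>sin (v * x) - v * x * indicator {x. \<bar>x\<bar> \<le> 1} x\<bar> \<le> 2 * (v * \<bar>x\<bar>) powr q" if "\<bar>x\<bar> \<le> c" for x
          using abs_sin_minus_id_le_powr[of q "v * x"] q that c v0 by (simp add: abs_mult)
        have "(\<integral>\<^sup>+x. ennreal (2 * (v * x) powr q * x powr (- \<beta> - 1)) * indicator {0<..c} x \<partial>lborel)
          = (\<integral>\<^sup>+x. ennreal (2 * v powr q) * (ennreal (x powr (q - 2)) * indicator {0<..c} x) \<partial>lborel)"
          using v0 \<beta> powr_add[of _ q "- 2"]
          by (intro nn_integral_cong) (auto simp: indicator_def powr_mult mult.assoc simp flip: ennreal_mult')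
        also have "\<dots> = ennreal (2 * v powr q) * ennreal (c powr (q - 1) / (q - 1))"
          using q c nn_integral_powr_from_0[of "q - 2" c] by (simp add: nn_integral_cmult)
        also have "\<dots> = ennreal (2 * v powr q * (c powr (q - 1) * L))"
          using q by (simp add: q_def flip: ennreal_mult')
        also have "\<dots> \<le> ennreal J"
        proof (intro ennreal_leI)
          have "v powr (1 / L) = exp (ln v / L)" using v0 by (simp add: powr_def)
          also have "\<dots> \<le> exp 1" using lnv L by simp
          also have "\<dots> \<le> 3" by (rule exp_le)
          finally have "v powr q \<le> v * 3"
            using v0 by (simp add: q_def powr_add)
          moreover have "c powr (q - 1) \<le> 1"
            using c q by (intro powr_le1) auto
          ultimately have "2 * v powr q * (c powr (q - 1) * L) \<le> 2 * (v * 3) * (1 * L)"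
            using v0 L by (intro mult_mono) auto
          then show "2 * v powr q * (c powr (q - 1) * L) \<le> J" by (simp add: J_def)
        qed
        finally show "(\<integral>\<^sup>+x. ennreal (2 * (v * x) powr q * x powr (- \<beta> - 1)) * indicator {0<..c} x \<partial>lborel) \<le> ennreal J" .
      qed (use v0 L abs_compensated_sin_le in \<open>auto simp: J_def\<close>)
    qed
    moreover have "\<bar>Im (levy_exponent a 0 \<nu> v)\<bar> \<le> \<bar>a\<bar> * v + \<bar>LINT x|\<nu>. sin (v * x) - v * x * indicator {x. \<bar>x\<bar> \<le> 1} x\<bar>"
      unfolding Im_levy_exponent[OF \<nu>] using abs_triangle_ineq4[of "- v * a"] v0 by (simp add: abs_mult mult.commute)
    moreover have "N \<le> N / \<delta> * v"
      using mult_left_mono[of \<delta> v "N / \<delta>"] v \<delta> N by simp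
    moreover have "(N / \<delta> * v + (\<bar>a\<bar> + N) * v) * 1 \<le> (N / \<delta> * v + (\<bar>a\<bar> + N) * v) * L"
      using N \<delta> v0 L by (intro mult_left_mono) auto
    ultimately show ?thesis by (simp add: J_def algebra_simps)
  qed
  then show ?thesis using C N \<delta> by (intro exI[of _ "12 * C + N / \<delta> + (\<bar>a\<bar> + N)"]) auto
qed

text \<open>
  With this drift the compensator cancels and the imaginary part is the integral of \<open>- sin (v x)\<close>
  alone.  Splitting the integral is legitimate because, for \<open>\<beta> < 1\<close>, \<open>sin (v x)\<close> is itself
  \<open>\<nu>\<close>-integrable.
\<close>
lemma Im_levy_exponent_le_below_1:
  assumes \<beta>: "0 < \<beta>" "\<beta> < 1" and \<delta>: "0 < \<delta>"
  shows "\<exists>A\<ge>0. \<forall>v>\<delta>. \<bar>Im (levy_exponent (LINT x:{x. \<bar>x\<bar> \<le> 1}|\<nu>. x) 0 \<nu> v)\<bar> \<le> A * v powr \<beta>"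
proof -
  have [measurable_cong]: "sets \<nu> = sets borel" using \<nu> by (simp add: levy_measure_def)
  define A1 where "A1 = 4 * C * (1 / (1 - \<beta>) + 1 / (\<beta> - 0))"
  define N where "N = measure \<nu> {x. c < \<bar>x\<bar>}"
  have A1: "0 \<le> A1" and N: "0 \<le> N" using \<beta> C by (auto simp: A1_def N_def)
  have sin_le: "(\<integral>\<^sup>+x. ennreal \<bar>sin (v * x)\<bar> \<partial>\<nu>) \<le> ennreal (A1 * v powr \<beta> + 1 * N)" if "0 < v" for v
    unfolding A1_def N_def
  proof (rule nn_integral_scaled_jumps_le[OF \<nu> c(1) less_imp_le[OF C] dom])
    show "\<bar>sin (v * x)\<bar> \<le> 2 * min (\<bar>v * x\<bar> powr 1) (\<bar>v * x\<bar> powr 0)" for x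
      by (rule abs_sin_le_min_powr)
  qed (use \<beta> that in auto)
  have sin_int: "integrable \<nu> (\<lambda>x. sin (v * x))" if "0 < v" for v
    using sin_le[OF that] by (intro integrableI_bounded) (auto intro: le_less_trans)
  have int: "integrable \<nu> (\<lambda>x. sin (v * x) - v * x * indicator {x. \<bar>x\<bar> \<le> 1} x)" for v
    using integrable_Im[OF levy_integrand_integrable[OF \<nu>, of v]] by (simp add: Im_exp)
  have "\<bar>Im (levy_exponent (LINT x:{x. \<bar>x\<bar> \<le> 1}|\<nu>. x) 0 \<nu> v)\<bar> \<le> (A1 + N * \<delta> powr (- \<beta>)) * v powr \<beta>" if v: "\<delta> < v" for v
  proof -
    have v0: "0 < v" using \<delta> v by simp
    have "(LINT x|\<nu>. v * x * indicator {x. \<bar>x\<bar> \<le> 1} x) = v * (LINT x:{x. \<bar>x\<bar> \<le> 1}|\<nu>. x)"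
      by (simp add: set_lebesgue_integral_def mult.assoc mult.commute[of "indicator _ _"])
    moreover have "(LINT x|\<nu>. sin (v * x) - v * x * indicator {x. \<bar>x\<bar> \<le> 1} x)
       = (LINT x|\<nu>. sin (v * x)) - (LINT x|\<nu>. v * x * indicator {x. \<bar>x\<bar> \<le> 1} x)"
      using Bochner_Integration.integrable_diff[OF sin_int[OF v0] int[of v]]
      by (intro Bochner_Integration.integral_diff sin_int v0) simp
    ultimately have "\<bar>Im (levy_exponent (LINT x:{x. \<bar>x\<bar> \<le> 1}|\<nu>. x) 0 \<nu> v)\<bar> = \<bar>LINT x|\<nu>. sin (v * x)\<bar>"
      unfolding Im_levy_exponent[OF \<nu>] by simp
    also have "\<dots> \<le> A1 * v powr \<beta> + 1 * N"
      using A1 N by (intro abs_integral_le_of_nn_integral_le sin_le v0) simp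
    also have "1 * N \<le> N * (\<delta> powr (- \<beta>) * v powr \<beta>)"
      using powr_absorb[of \<delta> v 0 \<beta>] \<delta> v \<beta> N mult_left_mono[of 1 "\<delta> powr (- \<beta>) * v powr \<beta>" N] by simp
    finally show ?thesis by (simp add: distrib_right mult.assoc)
  qed
  then show ?thesis using A1 N by (intro exI[of _ "A1 + N * \<delta> powr (- \<beta>)"]) auto
qed

end

section \<open>Removing the drift\<close>

lemma levy_process_minus_drift:
  assumes "levy_process M X"
  shows "levy_process M (\<lambda>t \<omega>. X t \<omega> - t * d)"
proof -
  interpret levy_process M X by fact
  show ?thesis
  proof
    show "random_variable borel (\<lambda>\<omega>. X t \<omega> - t * d)" if "0 \<le> t" for t
      using random_variable_X[OF that] by simp
    show "AE \<omega> in M. X 0 \<omega> - 0 * d = 0"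
      using X_zero by simp
    fix n :: nat and \<tau> :: "nat \<Rightarrow> real"
    assume \<tau>: "0 \<le> \<tau> 0" "\<And>i. i < n \<Longrightarrow> \<tau> i \<le> \<tau> (Suc i)"
    have "indep_vars (\<lambda>_. borel) (\<lambda>i \<omega>. (\<lambda>x. x - (\<tau> (Suc i) - \<tau> i) * d) (X (\<tau> (Suc i)) \<omega> - X (\<tau> i) \<omega>)) {..<n}"
      using \<tau> by (intro indep_vars_compose2[OF indep_increments]) auto
    then show "indep_vars (\<lambda>_. borel) (\<lambda>i \<omega>. X (\<tau> (Suc i)) \<omega> - \<tau> (Suc i) * d - (X (\<tau> i) \<omega> - \<tau> i * d)) {..<n}"
      by (simp add: algebra_simps)
  next
    fix s h :: real assume sh: "0 \<le> s" "0 \<le> h"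
    have [measurable]: "random_variable borel (X (s + h))" "random_variable borel (X (h + s))" "random_variable borel (X s)" "random_variable borel (X h)"
      using sh by (auto intro: random_variable_X)
    have "distr M borel (\<lambda>\<omega>. X (s + h) \<omega> - (s + h) * d - (X s \<omega> - s * d))
        = distr (distr M borel (\<lambda>\<omega>. X (s + h) \<omega> - X s \<omega>)) borel (\<lambda>x. x - h * d)"
      by (subst distr_distr) (auto simp: comp_def algebra_simps)
    also have "\<dots> = distr (distr M borel (X h)) borel (\<lambda>x. x - h * d)"
      using sh by (simp add: stationary_increments)
    also have "\<dots> = distr M borel (\<lambda>\<omega>. X h \<omega> - h * d)"
      by (subst distr_distr) (auto simp: comp_def)
    finally show "distr M borel (\<lambda>\<omega>. X (s + h) \<omega> - (s + h) * d - (X s \<omega> - s * d)) = distr M borel (\<lambda>\<omega>. X h \<omega> - h * d)" .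
  next
    show "AE \<omega> in M. cadlag (\<lambda>t. X t \<omega> - t * d)"
      using cadlag_paths
    proof eventually_elim
      case (elim \<omega>)
      show ?case
        unfolding cadlag_def
      proof (intro conjI allI impI)
        show "((\<lambda>t. X t \<omega> - t * d) \<longlongrightarrow> X t \<omega> - t * d) (at_right t)" if "0 \<le> t" for t
          using elim that by (auto simp: cadlag_def intro!: tendsto_intros)
        show "\<exists>l. ((\<lambda>t. X t \<omega> - t * d) \<longlongrightarrow> l) (at_left t)" if t: "0 < t" for t
        proof -
          obtain l where "((\<lambda>t. X t \<omega>) \<longlongrightarrow> l) (at_left t)"
            using elim t by (auto simp: cadlag_def)
          then have "((\<lambda>t. X t \<omega> - t * d) \<longlongrightarrow> l - t * d) (at_left t)"
            by (intro tendsto_intros)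
          then show ?thesis by blast
        qed
      qed
    qed
  qed
qed

lemma has_characteristics_minus_drift:
  assumes "has_characteristics M X a \<sigma>2 \<nu>"
  shows "has_characteristics M (\<lambda>t \<omega>. X t \<omega> - t * d) (a - d) \<sigma>2 \<nu>"
  unfolding has_characteristics_def
proof (intro conjI allI impI)
  fix u t :: real assume t: "0 \<le> t"
  have "(CLINT \<omega>|M. iexp (u * (X t \<omega> - t * d))) = (CLINT \<omega>|M. iexp (- u * t * d) * iexp (u * X t \<omega>))"
    by (intro Bochner_Integration.integral_cong) (auto simp: exp_add[symmetric] algebra_simps)
  also have "\<dots> = iexp (- u * t * d) * (CLINT \<omega>|M. iexp (u * X t \<omega>))"
    by simp
  also have "\<dots> = iexp (- u * t * d) * exp (- of_real t * levy_exponent a \<sigma>2 \<nu> u)"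
    using assms t by (auto simp: has_characteristics_def)
  also have "\<dots> = exp (- of_real t * levy_exponent (a - d) \<sigma>2 \<nu> u)"
    unfolding exp_add[symmetric] by (rule arg_cong[where f=exp]) (simp add: levy_exponent_def algebra_simps)
  finally show "(CLINT \<omega>|M. iexp (u * (X t \<omega> - t * d))) = exp (- of_real t * levy_exponent (a - d) \<sigma>2 \<nu> u)" .
qed (use assms in \<open>auto simp: has_characteristics_def\<close>)

lemma (in prob_space) integrable_abs_powr_shift:
  fixes Z :: "'a \<Rightarrow> real"
  assumes [measurable]: "random_variable borel Z" and p: "0 < p"
    and int: "integrable M (\<lambda>\<omega>. \<bar>Z \<omega>\<bar> powr p)"
  shows "integrable M (\<lambda>\<omega>. \<bar>Z \<omega> - d\<bar> powr p)"
proof (rule Bochner_Integration.integrable_bound)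
  show "integrable M (\<lambda>\<omega>. 2 powr p * \<bar>Z \<omega>\<bar> powr p + 2 powr p * \<bar>d\<bar> powr p)"
    using int by simp
  show "AE \<omega> in M. norm (\<bar>Z \<omega> - d\<bar> powr p) \<le> norm (2 powr p * \<bar>Z \<omega>\<bar> powr p + 2 powr p * \<bar>d\<bar> powr p)"
  proof (intro AE_I2)
    fix \<omega>
    have "\<bar>Z \<omega> - d\<bar> powr p \<le> (2 * max \<bar>Z \<omega>\<bar> \<bar>d\<bar>) powr p"
      using p by (intro powr_mono2) auto
    also have "\<dots> \<le> 2 powr p * \<bar>Z \<omega>\<bar> powr p + 2 powr p * \<bar>d\<bar> powr p"
      by (auto simp: max_def powr_mult)
    finally show "norm (\<bar>Z \<omega> - d\<bar> powr p) \<le> norm (2 powr p * \<bar>Z \<omega>\<bar> powr p + 2 powr p * \<bar>d\<bar> powr p)"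
      by simp
  qed
qed measurable

theorem theorem3:
  fixes M :: "'a measure" and X :: "real \<Rightarrow> 'a \<Rightarrow> real" and \<nu> :: "real measure"
    and a \<beta> p c C :: real
  assumes "levy_process M X"
    and "has_characteristics M X a 0 \<nu>"
    and "\<beta> = levy_index \<nu>" and "0 < \<beta>" and "\<beta> < 2"
    and "\<beta> \<noteq> 1 \<Longrightarrow> integrable M (\<lambda>\<omega>. \<bar>X 1 \<omega>\<bar> powr \<beta>)"
    and "\<beta> = 1 \<Longrightarrow> 0 < p \<and> p \<le> 1 \<and> integrable M (\<lambda>\<omega>. \<bar>X 1 \<omega>\<bar> powr p)"
    and "0 < c" and "c \<le> 1" and "0 < C"
    and "\<And>A. A \<in> sets borel \<Longrightarrow>
          emeasure (density \<nu> (indicator {x. 0 < \<bar>x\<bar> \<and> \<bar>x\<bar> \<le> c})) A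
            \<le> emeasure (density lborel
                 (\<lambda>x. ennreal (C / \<bar>x\<bar> powr (\<beta> + 1)) * indicator {x. 0 < \<bar>x\<bar> \<and> \<bar>x\<bar> \<le> c} x)) A"
  shows "(\<beta> > 1 \<longrightarrow> bigo_at_zero (sup_moment M X \<beta>) (\<lambda>t. t * (- ln t))) \<and>
    (\<beta> < 1 \<longrightarrow>
       bigo_at_zero
         (sup_moment M (\<lambda>t \<omega>. X t \<omega> - t * (a - (LINT x:{x. \<bar>x\<bar> \<le> 1}|\<nu>. x))) \<beta>)
         (\<lambda>t. t * (- ln t))) \<and>
    (\<beta> = 1 \<longrightarrow> bigo_at_zero (sup_moment M X p) (\<lambda>t. (t * (- ln t)) powr p))"
proof (intro conjI impI)
  interpret X: levy_process M X by fact
  have \<nu>: "levy_measure \<nu>" using assms(2) by (simp add: has_characteristics_def)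
  have X_exponent: "(CLINT \<omega>|M. iexp (u * X s \<omega>)) = exp (- of_real s * levy_exponent a 0 \<nu> u)" if "0 \<le> s" for u s
    using assms(2) that by (simp add: has_characteristics_def)
  have dom: "small_jumps_dominated \<nu> \<beta> c C"
    using assms(11) by (simp add: small_jumps_dominated_def)
  note jumps = \<nu> \<open>0 < c\<close> \<open>c \<le> 1\<close> \<open>0 < C\<close> dom
  note Re_bound = Re_levy_exponent_le[OF jumps \<open>0 < \<beta>\<close> \<open>\<beta> < 2\<close>]
  {
    assume \<beta>: "\<beta> > 1"
    obtain \<delta> where \<delta>: "0 < \<delta>" "\<delta> \<le> 1" "\<And>v. 0 < v \<Longrightarrow> v \<le> \<delta> \<Longrightarrow> cmod (levy_exponent a 0 \<nu> v) \<le> 1"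
      using levy_exponent_small[OF \<nu>] by blast
    obtain A1 where A1: "0 \<le> A1" "\<forall>v>\<delta>. Re (levy_exponent a 0 \<nu> v) \<le> A1 * v powr \<beta>"
      using Re_bound[OF \<delta>(1)] by blast
    obtain A2 where A2: "0 \<le> A2" "\<forall>v>\<delta>. \<bar>Im (levy_exponent a 0 \<nu> v)\<bar> \<le> A2 * v powr \<beta>"
      using Im_levy_exponent_le_above_1[OF jumps \<beta> \<open>\<beta> < 2\<close> \<delta>(1)] by blast
    show "bigo_at_zero (sup_moment M X \<beta>) (\<lambda>t. t * (- ln t))"
    proof (rule X.bigo_sup_moment_index[OF X_exponent \<delta> \<open>0 < \<beta>\<close> \<open>\<beta> < 2\<close>])
      show "integrable M (\<lambda>\<omega>. \<bar>X 1 \<omega>\<bar> powr \<beta>)" using assms(6) \<beta> by simp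
      show "0 \<le> A1 + A2" using A1 A2 by simp
      show "Re (levy_exponent a 0 \<nu> v) \<le> (A1 + A2) * v powr \<beta> \<and> \<bar>Im (levy_exponent a 0 \<nu> v)\<bar> \<le> (A1 + A2) * v powr \<beta>"
        if "\<delta> < v" for v
        using A1 A2 that by (auto simp: distrib_right intro: add_increasing add_increasing2)
    qed
  next
    assume \<beta>: "\<beta> < 1"
    define m where "m = (LINT x:{x. \<bar>x\<bar> \<le> 1}|\<nu>. x)"
    define Y where "Y t \<omega> = X t \<omega> - t * (a - m)" for t \<omega>
    interpret Y: levy_process M Y
      unfolding Y_def by (rule levy_process_minus_drift) fact
    have Y_exponent: "(CLINT \<omega>|M. iexp (u * Y s \<omega>)) = exp (- of_real s * levy_exponent m 0 \<nu> u)" if "0 \<le> s" for u s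
      using has_characteristics_minus_drift[OF assms(2), of "a - m"] that
      by (simp add: has_characteristics_def Y_def)
    obtain \<delta> where \<delta>: "0 < \<delta>" "\<delta> \<le> 1" "\<And>v. 0 < v \<Longrightarrow> v \<le> \<delta> \<Longrightarrow> cmod (levy_exponent m 0 \<nu> v) \<le> 1"
      using levy_exponent_small[OF \<nu>] by blast
    obtain A1 where A1: "0 \<le> A1" "\<forall>v>\<delta>. Re (levy_exponent m 0 \<nu> v) \<le> A1 * v powr \<beta>"
      using Re_bound[OF \<delta>(1)] by blast
    obtain A2 where A2: "0 \<le> A2" "\<forall>v>\<delta>. \<bar>Im (levy_exponent m 0 \<nu> v)\<bar> \<le> A2 * v powr \<beta>"
      unfolding m_def using Im_levy_exponent_le_below_1[OF jumps \<open>0 < \<beta>\<close> \<beta> \<delta>(1)] by blast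
    have "bigo_at_zero (sup_moment M Y \<beta>) (\<lambda>t. t * (- ln t))"
    proof (rule Y.bigo_sup_moment_index[OF Y_exponent \<delta> \<open>0 < \<beta>\<close> \<open>\<beta> < 2\<close>])
      show "integrable M (\<lambda>\<omega>. \<bar>Y 1 \<omega>\<bar> powr \<beta>)"
        unfolding Y_def using assms(6) \<beta> \<open>0 < \<beta>\<close>
        by (intro X.integrable_abs_powr_shift X.random_variable_X) auto
      show "0 \<le> A1 + A2" using A1 A2 by simp
      show "Re (levy_exponent m 0 \<nu> v) \<le> (A1 + A2) * v powr \<beta> \<and> \<bar>Im (levy_exponent m 0 \<nu> v)\<bar> \<le> (A1 + A2) * v powr \<beta>"
        if "\<delta> < v" for v
        using A1 A2 that by (auto simp: distrib_right intro: add_increasing add_increasing2)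
    qed
    then show "bigo_at_zero
         (sup_moment M (\<lambda>t \<omega>. X t \<omega> - t * (a - (LINT x:{x. \<bar>x\<bar> \<le> 1}|\<nu>. x))) \<beta>)
         (\<lambda>t. t * (- ln t))"
      by (simp add: Y_def[abs_def] m_def)
  next
    assume \<beta>: "\<beta> = 1"
    obtain \<delta> where \<delta>: "0 < \<delta>" "\<delta> \<le> 1" "\<And>v. 0 < v \<Longrightarrow> v \<le> \<delta> \<Longrightarrow> cmod (levy_exponent a 0 \<nu> v) \<le> 1"
      using levy_exponent_small[OF \<nu>] by blast
    obtain A1 where A1: "0 \<le> A1" "\<forall>v>\<delta>. Re (levy_exponent a 0 \<nu> v) \<le> A1 * v powr \<beta>"
      using Re_bound[OF \<delta>(1)] by blast
    obtain A2 where A2: "0 \<le> A2"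
        "\<forall>v>\<delta>. \<forall>L\<ge>1. ln v \<le> L \<longrightarrow> \<bar>Im (levy_exponent a 0 \<nu> v)\<bar> \<le> A2 * L * v"
      using Im_levy_exponent_le_at_1[OF jumps \<beta> \<delta>(1,2)] by blast
    show "bigo_at_zero (sup_moment M X p) (\<lambda>t. (t * (- ln t)) powr p)"
    proof (rule X.bigo_sup_moment_critical[OF X_exponent \<delta>])
      show "0 \<le> A1 + A2" using A1 A2 by simp
      show "Re (levy_exponent a 0 \<nu> v) \<le> (A1 + A2) * v" if "\<delta> < v" for v
        using A1 A2 that \<delta> \<beta> by (auto simp: distrib_right intro: add_increasing2)
      show "\<bar>Im (levy_exponent a 0 \<nu> v)\<bar> \<le> (A1 + A2) * L * v" if "\<delta> < v" "1 \<le> L" "ln v \<le> L" for v L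
      proof -
        have "\<bar>Im (levy_exponent a 0 \<nu> v)\<bar> \<le> A2 * L * v" using A2 that by blast
        also have "\<dots> \<le> (A1 + A2) * L * v"
          using A1 that \<delta> by (intro mult_right_mono) auto
        finally show ?thesis .
      qed
    qed (use assms(7) \<beta> in auto)
  }
qed

end
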